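(* Let $D$ be a degree-$5$ oriented multigraph with $n$ vertices. Then $\mathrm{fas}(D)\le \frac{24n}{29}$.
   Context: All digraphs are finite. An oriented multigraph is a directed multigraph (parallel arcs allowed) without loops and without directed cycles of length 2; arcs are counted with multiplicity. The degree of a vertex is the number of arcs incident with it (the sum of its out-degree and in-degree, counted with multiplicity). $D$ is degree-$k$ if every vertex of $D$ has degree exactly $k$. A set $F$ of arcs of $D$ is a feedback arc set if $D-F$ has no directed cycle; $\mathrm{fas}(D)$ is the minimum number of arcs in a feedback arc set of $D$. *)

theory Defs
  imports Complex_Main "Graph_Theory.Arc_Walk"
begin

text \<open>
  Parallel arcs are distinct elements of \<^term>\<open>arcs G\<close> with the same tail and the same head, so
  cardinalities of arc sets count arcs with multiplicity. The null digraph is admitted.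
\<close>

locale oriented_multigraph = fin_digraph + loopfree_digraph +
  assumes no_2_cycle: "cycle p \<Longrightarrow> length p \<noteq> 2"

definition degree :: "('a, 'b) pre_digraph \<Rightarrow> 'a \<Rightarrow> nat" where
  "degree G v = out_degree G v + in_degree G v"

definition degree_regular :: "nat \<Rightarrow> ('a, 'b) pre_digraph \<Rightarrow> bool" where
  "degree_regular k G \<longleftrightarrow> (\<forall>v \<in> verts G. degree G v = k)"

definition del_arcs :: "('a, 'b) pre_digraph \<Rightarrow> 'b set \<Rightarrow> ('a, 'b) pre_digraph" where
  "del_arcs G F = G\<lparr>arcs := arcs G - F\<rparr>"

definition feedback_arc_set :: "('a, 'b) pre_digraph \<Rightarrow> 'b set \<Rightarrow> bool" where
  "feedback_arc_set G F \<longleftrightarrow> F \<subseteq> arcs G \<and> (\<nexists>p. pre_digraph.cycle (del_arcs G F) p)"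

definition fas :: "('a, 'b) pre_digraph \<Rightarrow> nat" where
  "fas G = (LEAST k. \<exists>F. feedback_arc_set G F \<and> card F = k)"

text \<open>The minimum is over a nonempty set, hence attained.\<close>

lemma feedback_arc_set_arcs: "feedback_arc_set G (arcs G)"
  by (auto simp: feedback_arc_set_def del_arcs_def pre_digraph.cycle_def pre_digraph.awalk_def)

lemma fas_attained: "\<exists>F. feedback_arc_set G F \<and> card F = fas G"
  unfolding fas_def by (rule LeastI_ex) (use feedback_arc_set_arcs in blast)

end

theory Submission
  imports Defs
begin

text \<open>In a counterexample, the price 870 * min i j of removing a non-isolated vertex
  \<open>v\<close> exceeds the fall of the potential. Summed over all \<open>v\<close>, with the
  falls regrouped by the vertex \<open>w\<close> whose weight changes, this becomes local: the
  weight of \<open>w\<close> plus its drops over all incident arcs is compared with 870 * min i j.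
  The weights are tuned to that test. For simple arcs, (2, 3) gives 720 + 2 * 347 + 3 * 109 = 1741
  and (2, 2) gives 611 + 4 * 283 = 1743, against 1740; (1, 3) gives 373 + 373 + 3 * 45 = 881 against
  870; (1, 2) reaches only 328 + 328 + 2 * 38 = 732. The weight of (1, 1) is 870 / 3, because a
  triangle through such a vertex is destroyed for one arc while each of its three vertices loses at
  least 290. The obstacle is that several deficits may be charged to one \<open>v\<close>, up to
  552, so a single contraction is not enough. Two contractions return 580, but they must not disturb
  each other. A triangle blocks a contraction because it would turn into a 2-cycle; hence the many
  lemmas on triangles.\<close>

text \<open>
  A vertex of type \<open>(i, j)\<close> (in-degree, out-degree) receives a weight \<open>pot i j\<close>, measured in units
  of \<open>1/870\<close> of an arc, and the number of backward arcs of a suitable vertex order is bounded by the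
  total weight, for every oriented multigraph of maximum degree 5; vertices of degree 5 weigh
  \<open>720/870 = 24/29\<close>. In a counterexample with fewest arcs, removing a vertex at one end of the order
  costs \<open>min i j\<close> backward arcs and lowers the weights of the neighbours. Averaged over all vertices
  this pays off, except around vertices of type \<open>(1, 2)\<close> and \<open>(2, 1)\<close>, each of which causes a deficit
  of 138. After the removal of a neighbour such a vertex has type \<open>(1, 1)\<close>, and unless it lies in a
  triangle it can then be contracted for free, which gains 290. Local reductions (contracting
  vertices with a single in-arc, cancelling 2-cycles at the cost of one arc) exclude the
  configurations in which these gains do not cover the deficits.
\<close>


section \<open>The potential\<close>

text \<open>Sources and sinks weigh 0, as they can be removed for nothing. In degree 4 only the
  balanced type has min i j = 2, hence 611 against 373. The final value 720 also covers larger
  degrees, which keeps \<open>pot\<close> monotone everywhere.\<close>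

definition pot :: "nat \<Rightarrow> nat \<Rightarrow> nat" where
  "pot i j = (if i = 0 \<or> j = 0 then 0
     else if i + j = 2 then 290
     else if i + j = 3 then 328
     else if i = 2 \<and> j = 2 then 611
     else if i + j = 4 then 373
     else 720)"

lemma pot_0 [simp]: "pot 0 j = 0" "pot i 0 = 0"
  by (simp_all add: pot_def)

lemma pot_commute: "pot i j = pot j i"
  by (auto simp: pot_def)

lemma pot_le_720: "pot i j \<le> 720"
  by (simp add: pot_def)

lemma pot_mono:
  assumes "i' \<le> i" "j' \<le> j"
  shows "pot i' j' \<le> pot i j"
proof -
  have step: "pot i j \<le> pot (Suc i) j" for i j by (auto simp: pot_def)
  have "pot i' j' \<le> pot i j'" using step assms(1) by (rule lift_Suc_mono_le)
  also have "\<dots> \<le> pot i j"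
    using step assms(2) unfolding pot_commute[of i] by (rule lift_Suc_mono_le)
  finally show ?thesis .
qed

lemma pot_table [simp]:
  "pot (Suc 0) (Suc 0) = 290" "pot (Suc 0) 2 = 328" "pot 2 (Suc 0) = 328" "pot (Suc 0) 3 = 373" "pot 3 (Suc 0) = 373"
  "pot (Suc 0) 4 = 720" "pot 4 (Suc 0) = 720" "pot 2 2 = 611" "pot 2 3 = 720" "pot 3 2 = 720"
  by (simp_all add: pot_def)

lemma type_cases:
  assumes "i + j \<le> 5" "i \<ge> 1" "j \<ge> (1::nat)"
  shows "i = 1 \<and> j = 1 \<or> i = 1 \<and> j = 2 \<or> i = 1 \<and> j = 3 \<or> i = 1 \<and> j = 4 \<or> i = 2 \<and> j = 1 \<or>
    i = 2 \<and> j = 2 \<or> i = 2 \<and> j = 3 \<or> i = 3 \<and> j = 1 \<or> i = 3 \<and> j = 2 \<or> i = 4 \<and> j = 1"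
proof -
  consider "i = 1" | "i = 2" | "i = 3" | "i = 4" using assms by linarith
  then show ?thesis
  proof cases
    case 1
    then have "j = 1 \<or> j = 2 \<or> j = 3 \<or> j = 4" using assms by linarith
    with 1 show ?thesis by blast
  next
    case 2
    then have "j = 1 \<or> j = 2 \<or> j = 3" using assms by linarith
    with 2 show ?thesis by blast
  next
    case 3
    then have "j = 1 \<or> j = 2" using assms by linarith
    with 3 show ?thesis by blast
  next
    case 4
    then have "j = 1" using assms by linarith
    with 4 show ?thesis by blast
  qed
qed

text \<open>The worst drop per arc is 328 - 290 = 38, from (1, 2) to (1, 1).\<close>

lemma pot_drop_le:
  assumes "i + j \<le> 5" "1 \<le> i" "i \<le> j" "(i, j) \<noteq> (1, 1)" "i' \<le> i" "j' \<le> j"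
  shows "pot i' j' + 38 * (i - i' + (j - j')) \<le> pot i j"
proof -
  have "i = 1 \<and> (j = 2 \<or> j = 3 \<or> j = 4) \<or> i = 2 \<and> (j = 2 \<or> j = 3)" 
    using type_cases[of i j] assms(1-4) by fastforce
  moreover have "j' = 0 \<or> j' = 1 \<or> j' = 2 \<or> j' = 3 \<or> j' = 4" "i' = 0 \<or> i' = 1 \<or> i' = 2"
    using assms by linarith+
  ultimately show ?thesis using assms(5,6) by (elim disjE conjE; hypsubst; simp)
qed

lemma pot_drop:
  assumes "i + j \<le> 5" "i \<ge> 1" "j \<ge> 1" "(i, j) \<noteq> (1, 1)" "i' + a = i" "j' + b = j"
  shows "pot i' j' + 38 * (a + b) \<le> pot i j"
proof (cases "i \<le> j")
  case True
  then show ?thesis using pot_drop_le[of i j i' j'] assms by auto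
next
  case False
  then show ?thesis using pot_drop_le[of j i j' i'] assms by (auto simp: pot_commute add.commute)
qed

text \<open>The bounds are attained at (1, 1), and at (2, 2) with 611 - 290 = 321.\<close>

lemma pot_drop_11:
  assumes "i + j \<le> 5" "i \<ge> 1" "j \<ge> 1" "i' < i" "j' < j"
  shows "pot i' j' + 290 \<le> pot i j" "(i, j) \<noteq> (1, 1) \<Longrightarrow> pot i' j' + 321 \<le> pot i j"
proof -
  have *: "pot i' j' \<le> pot (i - 1) (j - 1)" using assms by (intro pot_mono) auto
  have "pot (i-1) (j-1) + 290 \<le> pot i j" "(i, j) \<noteq> (1, 1) \<Longrightarrow> pot (i-1) (j-1) + 321 \<le> pot i j"
    using type_cases[OF assms(1-3)] by (elim disjE conjE; simp)+
  with * show "pot i' j' + 290 \<le> pot i j" "(i, j) \<noteq> (1, 1) \<Longrightarrow> pot i' j' + 321 \<le> pot i j"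
    by (meson add_le_mono1 order_trans)+
qed

text \<open>Serves the two out-neighbours of \<open>u\<close> in \<open>no_double_triangle\<close>,
  which lose the arc from \<open>u\<close> and \<open>b\<close> arcs to \<open>x\<close>. Tight at
  (2, 2) with \<open>b = 1\<close>: 611 - 290 - 2 * 38 = 245. Type (1, 2) is left out, since
  \<open>b = 2\<close> would leave only 328 - 3 * 38 = 214.\<close>

lemma pot_drop_12:
  assumes "i = 1 \<and> j = 3 \<or> i = 2 \<and> j = 1 \<or> i = 2 \<and> j = 2 \<or> i = 2 \<and> j = 3 \<or> i = 3 \<and> j = 1 \<or> i = 3 \<and> j = 2"
    "b = 1 \<or> b = 2" "b \<le> j"
  shows "pot (i - 1) (j - b) + 38 * (1 + b) + 245 \<le> pot i j"
  using assms by (elim disjE conjE; hypsubst; simp add: pot_def)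

text \<open>The threshold is 259 = 870 - 328 - 283, the amount still missing in
  \<open>no_double_triangle\<close> after removing \<open>u\<close>. From (3, 2) to (2, 2) the drop
  is only 109.\<close>

lemma pot_drop_in:
  assumes "i = 1 \<and> j = 2 \<or> i = 1 \<and> j = 3 \<or> i = 2 \<and> j = 2 \<or> i = 2 \<and> j = 3 \<or> i = 3 \<and> j = 2"
  shows "i = 3 \<and> j = 2 \<and> pot i j = 720 \<or> pot (i - 1) j + 259 \<le> pot i j"
  using assms by (elim disjE conjE; hypsubst; simp add: pot_def)

text \<open>Linear lower bounds for the drop, tripled; \<open>a\<close> and \<open>b\<close> count
  the arcs between the vertex and a removed one, so one of them is 0. At (1, 3) a pair of parallel
  out-arcs drops 83, and 3 * 83 = 249 allows slope 124. The last bound holds because a doubled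
  out-arc at (1, 2) takes the whole 328.\<close>

lemma pot_slope:
  assumes "a = 0 \<or> b = 0" "a \<le> i" "b \<le> j"
  shows "i = 2 \<Longrightarrow> j = 3 \<Longrightarrow> 3 * pot (i - a) (j - b) + 1041 * a + 327 * b \<le> 3 * pot i j"
    and "i = 2 \<Longrightarrow> j = 2 \<Longrightarrow> 3 * pot (i - a) (j - b) + 849 * a + 849 * b \<le> 3 * pot i j"
    and "i = 1 \<Longrightarrow> j = 3 \<Longrightarrow> 3 * pot (i - a) (j - b) + 1119 * a + 124 * b \<le> 3 * pot i j"
    and "i = 1 \<Longrightarrow> j = 2 \<Longrightarrow> 3 * pot (i - a) (j - b) + 984 * a + 114 * b \<le> 3 * pot i j"
    and "i = 1 \<Longrightarrow> j = 2 \<Longrightarrow> b \<noteq> 1 \<Longrightarrow> 3 * pot (i - a) (j - b) + 984 * a + 492 * b \<le> 3 * pot i j"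
proof -
  have *: "a = 0 \<or> a = 1 \<or> a = 2" if "i \<le> 2" using that assms by linarith
  have **: "b = 0 \<or> b = 1 \<or> b = 2 \<or> b = 3" if "j \<le> 3" using that assms by linarith
  show "i = 2 \<Longrightarrow> j = 3 \<Longrightarrow> 3 * pot (i - a) (j - b) + 1041 * a + 327 * b \<le> 3 * pot i j"
    "i = 2 \<Longrightarrow> j = 2 \<Longrightarrow> 3 * pot (i - a) (j - b) + 849 * a + 849 * b \<le> 3 * pot i j"
    "i = 1 \<Longrightarrow> j = 3 \<Longrightarrow> 3 * pot (i - a) (j - b) + 1119 * a + 124 * b \<le> 3 * pot i j"
    "i = 1 \<Longrightarrow> j = 2 \<Longrightarrow> 3 * pot (i - a) (j - b) + 984 * a + 114 * b \<le> 3 * pot i j"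
    "i = 1 \<Longrightarrow> j = 2 \<Longrightarrow> b \<noteq> 1 \<Longrightarrow> 3 * pot (i - a) (j - b) + 984 * a + 492 * b \<le> 3 * pot i j"
    using * ** assms by (elim disjE; force simp: pot_def)+
qed

section \<open>Multigraphs as multiplicity functions\<close>

definition transp :: "('a \<Rightarrow> 'a \<Rightarrow> nat) \<Rightarrow> 'a \<Rightarrow> 'a \<Rightarrow> nat" where
  "transp m = (\<lambda>a b. m b a)"

text \<open>The vertex stays in \<open>V\<close>, isolated and of weight 0, so the vertex set is
  fixed throughout the induction.\<close>

definition del_vertex :: "'a \<Rightarrow> ('a \<Rightarrow> 'a \<Rightarrow> nat) \<Rightarrow> 'a \<Rightarrow> 'a \<Rightarrow> nat" where
  "del_vertex v m = (\<lambda>a b. if a = v \<or> b = v then 0 else m a b)"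

text \<open>Meant for the case that \<open>x u\<close> is the only arc into \<open>u\<close>: then \<open>u\<close> can be placed right after \<open>x\<close>.\<close>

definition contract :: "'a \<Rightarrow> 'a \<Rightarrow> ('a \<Rightarrow> 'a \<Rightarrow> nat) \<Rightarrow> 'a \<Rightarrow> 'a \<Rightarrow> nat" where
  "contract u x m = (\<lambda>a b. if a = u \<or> b = u then 0 else if a = x then m x b + m u b else m a b)"

definition cancel :: "'a \<Rightarrow> 'a \<Rightarrow> ('a \<Rightarrow> 'a \<Rightarrow> nat) \<Rightarrow> 'a \<Rightarrow> 'a \<Rightarrow> nat" where
  "cancel x y m = (\<lambda>a b. if (a, b) = (x, y) \<or> (a, b) = (y, x) then m a b - 1 else m a b)"

locale vertex_set =
  fixes V :: "'a set"
  assumes finite_V [simp, intro]: "finite V"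
begin

definition indeg :: "('a \<Rightarrow> 'a \<Rightarrow> nat) \<Rightarrow> 'a \<Rightarrow> nat" where
  "indeg m v = (\<Sum>w\<in>V. m w v)"

definition outdeg :: "('a \<Rightarrow> 'a \<Rightarrow> nat) \<Rightarrow> 'a \<Rightarrow> nat" where
  "outdeg m v = (\<Sum>w\<in>V. m v w)"

text \<open>Degrees are bounded rather than prescribed, so that the class survives removals and
  suitable contractions. The case \<open>u = v\<close> excludes loops.\<close>

definition admissible :: "('a \<Rightarrow> 'a \<Rightarrow> nat) \<Rightarrow> bool" where
  "admissible m \<longleftrightarrow> (\<forall>u v. m u v > 0 \<longrightarrow> u \<in> V \<and> v \<in> V \<and> m v u = 0) \<and> (\<forall>v\<in>V. indeg m v + outdeg m v \<le> 5)"

definition num_arcs :: "('a \<Rightarrow> 'a \<Rightarrow> nat) \<Rightarrow> nat" where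
  "num_arcs m = (\<Sum>u\<in>V. \<Sum>v\<in>V. m u v)"

definition back_arcs :: "('a \<Rightarrow> 'a \<Rightarrow> nat) \<Rightarrow> ('a \<Rightarrow> real) \<Rightarrow> nat" where
  "back_arcs m \<rho> = (\<Sum>u\<in>V. \<Sum>v\<in>V. if \<rho> v < \<rho> u then m u v else 0)"

text \<open>Orders are given by distinct real positions, which leaves room to insert a vertex
  between any two others.\<close>

definition back_bound :: "('a \<Rightarrow> 'a \<Rightarrow> nat) \<Rightarrow> nat \<Rightarrow> bool" where
  "back_bound m B \<longleftrightarrow> (\<exists>\<rho>. inj_on \<rho> V \<and> 870 * back_arcs m \<rho> \<le> B)"

definition weight :: "('a \<Rightarrow> 'a \<Rightarrow> nat) \<Rightarrow> 'a \<Rightarrow> nat" where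
  "weight m v = pot (indeg m v) (outdeg m v)"

definition potential :: "('a \<Rightarrow> 'a \<Rightarrow> nat) \<Rightarrow> nat" where
  "potential m = (\<Sum>v\<in>V. weight m v)"

subsection \<open>Transposition\<close>

lemma indeg_transp [simp]: "indeg (transp m) v = outdeg m v"
  and outdeg_transp [simp]: "outdeg (transp m) v = indeg m v"
  by (simp_all add: indeg_def outdeg_def transp_def)

lemma transp_apply: "transp m a b = m b a"
  by (simp add: transp_def)

lemma transp_transp [simp]: "transp (transp m) = m"
  by (simp add: transp_def)

lemma admissible_transp: "admissible m \<Longrightarrow> admissible (transp m)"
  unfolding admissible_def by (auto simp: add.commute transp_apply)

lemma weight_transp [simp]: "weight (transp m) v = weight m v"
  by (simp add: weight_def pot_commute)

lemma potential_transp [simp]: "potential (transp m) = potential m"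
  by (simp add: potential_def)

lemma num_arcs_transp [simp]: "num_arcs (transp m) = num_arcs m"
  unfolding num_arcs_def transp_apply by (rule sum.swap)

lemma back_bound_transp: "back_bound (transp m) B \<longleftrightarrow> back_bound m B"
proof -
  have *: "back_bound (transp m) B" if b: "back_bound m B" for m :: "'a \<Rightarrow> 'a \<Rightarrow> nat"
  proof -
    obtain \<rho> where \<rho>: "inj_on \<rho> V" "870 * back_arcs m \<rho> \<le> B" using b by (auto simp: back_bound_def)
    have "back_arcs (transp m) (\<lambda>v. - \<rho> v) = back_arcs m \<rho>"
      unfolding back_arcs_def transp_apply by (subst sum.swap) simp
    moreover have "inj_on (\<lambda>v. - \<rho> v) V" using \<rho>(1) by (auto simp: inj_on_def)
    ultimately show ?thesis using \<rho>(2) unfolding back_bound_def by auto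
  qed
  show ?thesis using *[of m] *[of "transp m"] by auto
qed

subsection \<open>Degrees\<close>

lemma back_bound_mono: "back_bound m B \<Longrightarrow> B \<le> B' \<Longrightarrow> back_bound m B'"
  unfolding back_bound_def by (meson order_trans)

lemma goodD:
  assumes "admissible m"
  shows "m u v > 0 \<Longrightarrow> u \<in> V" "m u v > 0 \<Longrightarrow> v \<in> V" "m u v > 0 \<Longrightarrow> m v u = 0" "m v v = 0"
    "v \<in> V \<Longrightarrow> indeg m v + outdeg m v \<le> 5"
proof -
  show *: "m u v > 0 \<Longrightarrow> m v u = 0" for u v using assms unfolding admissible_def by blast
  show "m v v = 0" using *[of v v] by (cases "m v v = 0") auto
qed (use assms in \<open>auto simp: admissible_def\<close>)

lemma indeg_remove: "x \<in> V \<Longrightarrow> indeg m v = m x v + (\<Sum>w\<in>V - {x}. m w v)"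
  unfolding indeg_def by (rule sum.remove) auto

lemma outdeg_remove: "x \<in> V \<Longrightarrow> outdeg m v = m v x + (\<Sum>w\<in>V - {x}. m v w)"
  unfolding outdeg_def by (rule sum.remove) auto

lemma le_indeg: "x \<in> V \<Longrightarrow> m x v \<le> indeg m v"
  by (simp add: indeg_remove)

lemma le_outdeg: "x \<in> V \<Longrightarrow> m v x \<le> outdeg m v"
  by (simp add: outdeg_remove)

lemma le_ind2: "x \<in> V \<Longrightarrow> y \<in> V \<Longrightarrow> x \<noteq> y \<Longrightarrow> m x v + m y v \<le> indeg m v"
  unfolding indeg_def using sum_mono2[of V "{x, y}" "\<lambda>w. m w v"] by simp

lemma le_outd2: "x \<in> V \<Longrightarrow> y \<in> V \<Longrightarrow> x \<noteq> y \<Longrightarrow> m v x + m v y \<le> outdeg m v"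
  using le_ind2[of x y "transp m" v] by (simp add: transp_apply)

lemma indeg_del: "v \<in> V \<Longrightarrow> w \<noteq> v \<Longrightarrow> indeg m w = indeg (del_vertex v m) w + m v w"
  unfolding indeg_remove[of v] by (simp add: indeg_remove[of v] del_vertex_def)

lemma outdeg_del: "v \<in> V \<Longrightarrow> w \<noteq> v \<Longrightarrow> outdeg m w = outdeg (del_vertex v m) w + m w v"
  unfolding outdeg_remove[of v] by (simp add: outdeg_remove[of v] del_vertex_def)

lemma indeg_del_self [simp]: "indeg (del_vertex v m) v = 0" and outdeg_del_self [simp]: "outdeg (del_vertex v m) v = 0"
  by (simp_all add: indeg_def outdeg_def del_vertex_def)

lemma del_le: "del_vertex v m a b \<le> m a b"
  by (simp add: del_vertex_def)

lemma indeg_mono: "(\<And>a b. m' a b \<le> m a b) \<Longrightarrow> indeg m' v \<le> indeg m v"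
  unfolding indeg_def by (rule sum_mono)

lemma outdeg_mono: "(\<And>a b. m' a b \<le> m a b) \<Longrightarrow> outdeg m' v \<le> outdeg m v"
  unfolding outdeg_def by (rule sum_mono)

lemma admissible_mono:
  assumes "admissible m" "\<And>a b. m' a b \<le> m a b"
  shows "admissible m'"
  unfolding admissible_def
proof (intro conjI allI impI ballI)
  fix u v assume "m' u v > 0"
  then have "m u v > 0" using assms(2)[of u v] by linarith
  then show "u \<in> V" "v \<in> V" "m' v u = 0"
    using goodD(1-3)[OF assms(1), of u v] assms(2)[of v u] by auto
next
  fix v assume "v \<in> V"
  then show "indeg m' v + outdeg m' v \<le> 5"
    using goodD(5)[OF assms(1), of v] indeg_mono[of m' m v, OF assms(2)] outdeg_mono[of m' m v, OF assms(2)]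
    by linarith
qed

lemma admissible_del: "admissible m \<Longrightarrow> admissible (del_vertex v m)"
  by (erule admissible_mono) (rule del_le)

lemma weight_mono: "(\<And>a b. m' a b \<le> m a b) \<Longrightarrow> weight m' v \<le> weight m v"
  unfolding weight_def by (intro pot_mono indeg_mono outdeg_mono)

lemma potential_mono: "(\<And>a b. m' a b \<le> m a b) \<Longrightarrow> potential m' \<le> potential m"
  unfolding potential_def by (intro sum_mono weight_mono)

lemma num_arcs_alt: "num_arcs m = (\<Sum>v\<in>V. outdeg m v)"
  by (simp add: num_arcs_def outdeg_def)

lemma num_arcs_alt_in: "num_arcs m = (\<Sum>v\<in>V. indeg m v)"
  unfolding num_arcs_def indeg_def by (rule sum.swap)

lemma num_arcs_less:
  assumes "\<And>a b. m' a b \<le> m a b" "u \<in> V" "v \<in> V" "m' u v < m u v"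
  shows "num_arcs m' < num_arcs m"
  unfolding num_arcs_alt
proof (rule sum_strict_mono_ex1)
  show "\<forall>w\<in>V. outdeg m' w \<le> outdeg m w" using outdeg_mono[OF assms(1)] by auto
  have "outdeg m' u < outdeg m u" unfolding outdeg_def
    using assms by (intro sum_strict_mono_ex1) auto
  then show "\<exists>w\<in>V. outdeg m' w < outdeg m w" using assms(2) by blast
qed simp

lemma exists_in: "indeg m v > 0 \<Longrightarrow> \<exists>w\<in>V. m w v > 0"
  unfolding indeg_def by (metis not_gr_zero sum.neutral)

lemma exists_out: "outdeg m v > 0 \<Longrightarrow> \<exists>w\<in>V. m v w > 0"
  using exists_in[of "transp m" v] by (simp add: transp_apply)

lemma num_arcs_del:
  assumes "v \<in> V" "indeg m v > 0 \<or> outdeg m v > 0"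
  shows "num_arcs (del_vertex v m) < num_arcs m"
proof -
  obtain a b where "a \<in> V" "b \<in> V" "a = v \<or> b = v" "m a b > 0"
    using assms exists_in exists_out by metis
  then show ?thesis using assms by (intro num_arcs_less[of _ _ a b] del_le) (auto simp: del_vertex_def)
qed

lemma potential_diff:
  assumes "S \<subseteq> V" "\<And>w. w \<in> V - S \<Longrightarrow> weight m' w \<le> weight m w"
  shows "potential m' + (\<Sum>w\<in>S. weight m w) \<le> potential m + (\<Sum>w\<in>S. weight m' w)"
proof -
  have *: "potential k = (\<Sum>w\<in>V - S. weight k w) + (\<Sum>w\<in>S. weight k w)" for k
    unfolding potential_def using assms(1) by (intro sum.subset_diff) auto
  have "(\<Sum>w\<in>V - S. weight m' w) \<le> (\<Sum>w\<in>V - S. weight m w)" using assms(2) by (rule sum_mono)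
  then show ?thesis using *[of m] *[of m'] by linarith
qed

subsection \<open>Reductions\<close>

text \<open>Placed last, \<open>v\<close> makes exactly its out-arcs backward; placed first, its
  in-arcs, which is the same argument for the transpose.\<close>

lemma back_bound_del:
  assumes "v \<in> V" "back_bound (del_vertex v m) B"
  shows "back_bound m (B + 870 * min (indeg m v) (outdeg m v))"
proof -
  have *: "back_bound m (B + 870 * outdeg m v)" if b: "back_bound (del_vertex v m) B" for m
  proof -
    obtain \<rho> where \<rho>: "inj_on \<rho> V" "870 * back_arcs (del_vertex v m) \<rho> \<le> B" using b by (auto simp: back_bound_def)
    define M where "M = Max (\<rho> ` V) + 1"
    have M: "\<rho> w < M" if "w \<in> V" for w
    proof -
      have "\<rho> w \<le> Max (\<rho> ` V)" using that by simp
      then show ?thesis unfolding M_def by linarith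
    qed
    define \<rho>' where "\<rho>' = \<rho>(v := M)"
    have inj: "inj_on \<rho>' V"
      using \<rho>(1) M unfolding \<rho>'_def inj_on_def by (simp add: less_imp_neq) (metis less_irrefl)
    have "back_arcs m \<rho>' \<le> (\<Sum>a\<in>V. \<Sum>b\<in>V. (if \<rho> b < \<rho> a then del_vertex v m a b else 0) + (if a = v then m v b else 0))"
      unfolding back_arcs_def
    proof (intro sum_mono)
      fix a b assume "a \<in> V" "b \<in> V"
      then show "(if \<rho>' b < \<rho>' a then m a b else 0) \<le>
        (if \<rho> b < \<rho> a then del_vertex v m a b else 0) + (if a = v then m v b else 0)"
        using M[of a] M[of b] by (auto simp: \<rho>'_def del_vertex_def)
    qed
    also have "\<dots> = back_arcs (del_vertex v m) \<rho> + (\<Sum>b\<in>V. \<Sum>a\<in>V. if a = v then m v b else 0)"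
      unfolding back_arcs_def sum.distrib by (subst (3) sum.swap) simp
    also have "\<dots> = back_arcs (del_vertex v m) \<rho> + outdeg m v" using assms(1) by (simp add: outdeg_def)
    finally show ?thesis using \<rho>(2) inj unfolding back_bound_def by (intro exI[of _ \<rho>']) auto
  qed
  have "del_vertex v (transp m) = transp (del_vertex v m)" by (auto simp: del_vertex_def transp_def fun_eq_iff)
  then have "back_bound m (B + 870 * indeg m v)"
    using *[of "transp m"] assms(2) by (simp add: back_bound_transp)
  with *[OF assms(2)] show ?thesis by (simp add: min_def)
qed

text \<open>Of two opposite arcs every order makes exactly one backward.\<close>

lemma back_bound_cancel:
  assumes "x \<in> V" "y \<in> V" "x \<noteq> y" "m x y > 0" "m y x > 0" "back_bound (cancel x y m) B"
  shows "back_bound m (B + 870)"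
proof -
  obtain \<rho> where \<rho>: "inj_on \<rho> V" "870 * back_arcs (cancel x y m) \<rho> \<le> B" using assms by (auto simp: back_bound_def)
  have ne: "\<rho> x \<noteq> \<rho> y" using \<rho>(1) assms by (auto simp: inj_on_def)
  define p where "p = (if \<rho> y < \<rho> x then x else y)"
  define q where "q = (if \<rho> y < \<rho> x then y else x)"
  have "back_arcs m \<rho> \<le> (\<Sum>a\<in>V. \<Sum>b\<in>V. (if \<rho> b < \<rho> a then cancel x y m a b else 0) + (if b = q then if a = p then 1 else 0 else 0))"
    unfolding back_arcs_def
  proof (intro sum_mono)
    fix a b assume "a \<in> V" "b \<in> V"
    show "(if \<rho> b < \<rho> a then m a b else 0) \<le>
      (if \<rho> b < \<rho> a then cancel x y m a b else 0) + (if b = q then if a = p then 1 else 0 else 0)"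
      using ne assms(3-5) by (auto simp: p_def q_def cancel_def)
  qed
  also have "\<dots> = back_arcs (cancel x y m) \<rho> + 1"
  proof -
    have "p \<in> V" "q \<in> V" using assms(1,2) by (auto simp: p_def q_def)
    then show ?thesis unfolding back_arcs_def sum.distrib by simp
  qed
  finally show ?thesis using \<rho> unfolding back_bound_def by (intro exI[of _ \<rho>]) auto
qed

text \<open>With \<open>u\<close> directly after \<open>x\<close>, the arc \<open>x u\<close> is
  forward, and every out-arc of \<open>u\<close> is backward exactly when the arc from
  \<open>x\<close> that replaces it is.\<close>

lemma back_bound_contract:
  assumes g: "admissible m" and u: "indeg m u = 1" "m x u > 0" and b: "back_bound (contract u x m) B"
  shows "back_bound m B"
proof -
  note d = goodD(1-3)[OF g u(2)]
  then have V: "x \<in> V" "u \<in> V" and xu: "x \<noteq> u" and ux: "m u x = 0"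
    using u by auto
  have pred: "m a u = 0" if "a \<in> V" "a \<noteq> x" for a
    using le_ind2[of a x m u] that V u by auto
  obtain \<rho> where \<rho>: "inj_on \<rho> V" "870 * back_arcs (contract u x m) \<rho> \<le> B" using b by (auto simp: back_bound_def)
  \<comment> \<open>A position between \<open>x\<close> and the next higher vertex; if
    \<open>x\<close> is the highest, any larger number.\<close>
  obtain t where t: "t > \<rho> x" "\<And>w. w \<in> V \<Longrightarrow> \<rho> w > \<rho> x \<Longrightarrow> t < \<rho> w"
  proof (cases "{w \<in> V. \<rho> w > \<rho> x} = {}")
    case True
    then show ?thesis using that[of "\<rho> x + 1"] by auto
  next
    case False
    define M where "M = Min (\<rho> ` {w \<in> V. \<rho> w > \<rho> x})"
    have "M > \<rho> x" unfolding M_def using False by (subst Min_gr_iff) auto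
    moreover have "M \<le> \<rho> w" if "w \<in> V" "\<rho> w > \<rho> x" for w unfolding M_def using that by (intro Min_le) auto
    ultimately show ?thesis using that[of "(\<rho> x + M) / 2"] by force
  qed
  define \<rho>' where "\<rho>' = \<rho>(u := t)"
  have tne: "\<rho> w \<noteq> t" if "w \<in> V" for w using t(1) t(2)[OF that] by fastforce
  have inj: "inj_on \<rho>' V" using \<rho>(1) tne unfolding \<rho>'_def inj_on_def by (auto; metis)
  define R where "R b = (if \<rho> b < \<rho> x \<and> b \<noteq> u then m u b else 0)" for b
  define T where "T a b = (if \<rho>' b < \<rho>' a then m a b else 0)" for a b
  define C where "C a b = (if \<rho> b < \<rho> a then contract u x m a b else 0)" for a b
  have Tu: "T u b \<le> R b" if "b \<in> V" for b
  proof -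
    have "b \<noteq> x \<Longrightarrow> \<rho> b \<noteq> \<rho> x" using \<rho>(1) V that by (auto simp: inj_on_def)
    then show ?thesis using that t ux by (auto simp: T_def R_def \<rho>'_def; force)
  qed
  have C: "C a b = T a b + (if a = x then R b else 0)" if "a \<in> V - {u}" "b \<in> V" for a b
    using that pred[of a] xu t(1) by (auto simp: C_def T_def R_def \<rho>'_def contract_def)
  have "back_arcs m \<rho>' = (\<Sum>b\<in>V. T u b) + (\<Sum>a\<in>V - {u}. \<Sum>b\<in>V. T a b)"
    unfolding back_arcs_def T_def using V by (subst sum.remove[of V u]) auto
  also have "\<dots> \<le> (\<Sum>b\<in>V. R b) + (\<Sum>a\<in>V - {u}. \<Sum>b\<in>V. T a b)"
    using Tu by (intro add_mono sum_mono) auto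
  also have "(\<Sum>b\<in>V. R b) = (\<Sum>a\<in>V - {u}. if a = x then \<Sum>b\<in>V. R b else 0)" using V xu by simp
  also have "\<dots> + (\<Sum>a\<in>V - {u}. \<Sum>b\<in>V. T a b) = (\<Sum>a\<in>V - {u}. \<Sum>b\<in>V. C a b)"
    unfolding sum.distrib[symmetric]
  proof (rule sum.cong[OF refl])
    fix a assume a: "a \<in> V - {u}"
    have "(\<Sum>b\<in>V. C a b) = (\<Sum>b\<in>V. T a b) + (\<Sum>b\<in>V. if a = x then R b else 0)"
      unfolding sum.distrib[symmetric] using C[OF a] by (intro sum.cong) auto
    then show "(if a = x then \<Sum>b\<in>V. R b else 0) + (\<Sum>b\<in>V. T a b) = (\<Sum>b\<in>V. C a b)" by simp
  qed
  also have "\<dots> = back_arcs (contract u x m) \<rho>"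
    unfolding back_arcs_def C_def[symmetric] using V by (subst sum.remove[of V u]) (auto simp: C_def contract_def)
  finally show ?thesis using \<rho>(2) inj unfolding back_bound_def by (intro exI[of _ \<rho>']) auto
qed

lemma contract_degrees:
  assumes g: "admissible m" and u: "indeg m u = 1" "m x u > 0"
  shows "w \<noteq> u \<Longrightarrow> indeg (contract u x m) w = indeg m w"
    and "w \<noteq> u \<Longrightarrow> w \<noteq> x \<Longrightarrow> outdeg (contract u x m) w = outdeg m w"
    and "outdeg (contract u x m) x + 1 = outdeg m x + outdeg m u"
    and "indeg (contract u x m) u = 0" "outdeg (contract u x m) u = 0"
proof -
  note d = goodD(1-3)[OF g u(2)]
  then have V: "x \<in> V" "u \<in> V" and xu: "x \<noteq> u" and ux: "m u x = 0" and xu1: "m x u = 1"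
    using u le_indeg[of x m u] by auto
  have pred: "m a u = 0" if "a \<noteq> x" for a
    using le_ind2[of a x m u] goodD(1)[OF g, of a u] that V u by (cases "m a u = 0") auto
  show "indeg (contract u x m) u = 0" "outdeg (contract u x m) u = 0"
    by (simp_all add: indeg_def outdeg_def contract_def)
  have split: "(\<Sum>w\<in>V. f w) = f x + f u + (\<Sum>w\<in>V - {x, u}. f w)" for f :: "'a \<Rightarrow> nat"
    using V xu sum.subset_diff[of "{x,u}" V f] by simp
  show "indeg (contract u x m) w = indeg m w" if "w \<noteq> u"
    unfolding indeg_def split using that xu by (simp add: contract_def)
  show "outdeg (contract u x m) w = outdeg m w" if "w \<noteq> u" "w \<noteq> x"
    unfolding outdeg_def split using that xu pred[of w] by (simp add: contract_def)
  have "m u u = 0" "m x x = 0" using goodD(4)[OF g] by auto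
  then show "outdeg (contract u x m) x + 1 = outdeg m x + outdeg m u"
    unfolding outdeg_def split using xu ux xu1 by (simp add: contract_def sum.distrib)
qed

text \<open>An arc \<open>u w\<close> together with \<open>w x\<close> would become a 2-cycle, hence
  \<open>tri\<close>. The bound is 6 because the arc \<open>x u\<close> disappears from the merged
  vertex.\<close>

lemma admissible_contract:
  assumes g: "admissible m" and u: "indeg m u = 1" "m x u > 0"
    and tri: "\<And>w. m u w > 0 \<Longrightarrow> m w x = 0" and d: "indeg m x + outdeg m x + outdeg m u \<le> 6"
  shows "admissible (contract u x m)"
  unfolding admissible_def
proof (intro conjI allI impI ballI)
  fix a b assume ab: "contract u x m a b > 0"
  then have ne: "a \<noteq> u" "b \<noteq> u" by (auto simp: contract_def split: if_splits)
  note xu = goodD(1-3)[OF g u(2)]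
  consider "m a b > 0" | "a = x" "m u b > 0" using ab by (auto simp: contract_def split: if_splits)
  then have "a \<in> V \<and> b \<in> V \<and> contract u x m b a = 0"
  proof cases
    case 1
    then have "b = x \<Longrightarrow> m u a = 0" using tri[of a] by (cases "m u a = 0") auto
    with 1 show ?thesis using goodD(1-3)[OF g 1] by (auto simp: contract_def)
  next
    case 2
    have "b \<noteq> x" using 2 xu by auto
    with 2 show ?thesis using xu(1) goodD(2)[OF g 2(2)] tri[OF 2(2)] by (simp add: contract_def)
  qed
  then show "a \<in> V" "b \<in> V" "contract u x m b a = 0" by auto
next
  fix w assume "w \<in> V"
  show "indeg (contract u x m) w + outdeg (contract u x m) w \<le> 5"
  proof (cases "w = x")
    case True
    moreover have "x \<noteq> u" using goodD(3)[OF g u(2)] u(2) by auto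
    ultimately show ?thesis using contract_degrees(1)[OF g u, of x] contract_degrees(3)[OF g u] d by auto
  next
    case False
    then show ?thesis
      using contract_degrees[OF g u] goodD(5)[OF g \<open>w \<in> V\<close>] by (cases "w = u") auto
  qed
qed

lemma num_arcs_contract:
  assumes g: "admissible m" and u: "indeg m u = 1" "m x u > 0"
  shows "num_arcs (contract u x m) < num_arcs m"
proof -
  have "u \<in> V" using goodD(2)[OF g u(2)] .
  have "indeg (contract u x m) w \<le> indeg m w" for w using contract_degrees[OF g u] by (cases "w = u") auto
  moreover have "indeg (contract u x m) u < indeg m u" using contract_degrees(4)[OF g u] u by simp
  ultimately show ?thesis unfolding num_arcs_alt_in
    using \<open>u \<in> V\<close> by (intro sum_strict_mono_ex1) auto
qed

lemma cancel_degrees: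
  assumes "x \<in> V" "y \<in> V" "x \<noteq> y" "m x y > 0" "m y x > 0"
  shows "indeg (cancel x y m) w = (if w = x \<or> w = y then indeg m w - 1 else indeg m w)"
    and "outdeg (cancel x y m) w = (if w = x \<or> w = y then outdeg m w - 1 else outdeg m w)"
proof -
  have split: "(\<Sum>w\<in>V. f w) = f x + f y + (\<Sum>w\<in>V - {x, y}. f w)" for f :: "'a \<Rightarrow> nat"
    using assms sum.subset_diff[of "{x,y}" V f] by simp
  show "indeg (cancel x y m) w = (if w = x \<or> w = y then indeg m w - 1 else indeg m w)"
    "outdeg (cancel x y m) w = (if w = x \<or> w = y then outdeg m w - 1 else outdeg m w)"
    unfolding indeg_def outdeg_def split using assms by (auto simp: cancel_def)
qed


lemma num_arcs_mono: "(\<And>a b. m' a b \<le> m a b) \<Longrightarrow> num_arcs m' \<le> num_arcs m"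
  unfolding num_arcs_def by (intro sum_mono)

lemma weight_isolated [simp]: "indeg m v = 0 \<Longrightarrow> weight m v = 0" "outdeg m v = 0 \<Longrightarrow> weight m v = 0"
  by (simp_all add: weight_def)

lemma contract_potential:
  assumes g: "admissible m" and u: "indeg m u = 1" "m x u > 0" "outdeg m u = Suc k"
  shows "potential (contract u x m) + weight m u + weight m x \<le> potential m + pot (indeg m x) (outdeg m x + k)"
proof -
  note deg = contract_degrees[OF g u(1,2)]
  note d = goodD(1-3)[OF g u(2)]
  then have xu: "x \<noteq> u" using u(2) by auto
  have "potential (contract u x m) + (\<Sum>w\<in>{u, x}. weight m w) \<le> potential m + (\<Sum>w\<in>{u, x}. weight (contract u x m) w)"
    using d deg by (intro potential_diff) (auto simp: weight_def)
  moreover have "weight (contract u x m) x = pot (indeg m x) (outdeg m x + k)"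
    using deg(1)[of x] deg(3) xu u(3) by (simp add: weight_def)
  moreover have "weight (contract u x m) u = 0" using deg by simp
  ultimately show ?thesis using xu by simp
qed

text \<open>The triangle \<open>x u y\<close> collapses to a 2-cycle. As \<open>u y\<close> is a
  single arc, cancelling one pair leaves no arc from \<open>x\<close> to \<open>y\<close>. The
  merged vertex loses three arc ends (\<open>x u\<close> and the cancelled pair), hence the bound
  8.\<close>

lemma contract_cancel_facts:
  assumes g: "admissible m" and u: "indeg m u = 1" "m x u > 0" and y: "m u y = 1" "m y x > 0"
    and tri: "\<And>w. w \<noteq> y \<Longrightarrow> m u w > 0 \<Longrightarrow> m w x = 0"
    and d: "indeg m x + outdeg m x + outdeg m u \<le> 8"
  defines "m' \<equiv> cancel x y (contract u x m)"
  shows "admissible m'" "num_arcs m' < num_arcs m" "back_bound m' B \<Longrightarrow> back_bound m (B + 870)"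
    "potential m' + weight m u + weight m x + weight m y \<le>
       potential m + pot (indeg m x - 1) (outdeg m x + outdeg m u - 2) + pot (indeg m y - 1) (outdeg m y - 1)"
proof -
  define k where "k = contract u x m"
  note xu = goodD(1-3)[OF g u(2)]
  note yx = goodD(1-3)[OF g y(2)]
  have uy: "u \<in> V" "y \<in> V" "m y u = 0" using goodD(1-3)[OF g, of u y] y by auto
  have ne: "x \<noteq> u" "y \<noteq> x" "y \<noteq> u" using xu yx uy u y by auto
  have kxy: "k x y = 1" "k y x = m y x" using yx ne y by (auto simp: k_def contract_def)
  have deg: "indeg k w = indeg m w" "w \<noteq> x \<Longrightarrow> outdeg k w = outdeg m w" if "w \<noteq> u" for w
    using contract_degrees(1,2)[OF g u, of w] that by (auto simp: k_def)
  have degu: "indeg k u = 0" "outdeg k u = 0" "outdeg k x = outdeg m x + outdeg m u - 1"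
    using contract_degrees[OF g u] by (auto simp: k_def)
  have deg': "indeg m' w = (if w = x \<or> w = y then indeg k w - 1 else indeg k w)"
    "outdeg m' w = (if w = x \<or> w = y then outdeg k w - 1 else outdeg k w)" for w
    using cancel_degrees[of x y k w] xu yx ne kxy y by (auto simp: m'_def k_def)
  have m'_le: "m' a b \<le> k a b" for a b by (auto simp: m'_def k_def cancel_def)
  have "outdeg m u > 0" using le_outdeg[of y m u] uy y by simp
  show "admissible m'"
    unfolding admissible_def
  proof (intro conjI allI impI ballI)
    fix a b assume ab: "m' a b > 0"
    then have kab: "k a b > 0" using m'_le[of a b] by linarith
    then have nu: "a \<noteq> u" "b \<noteq> u" by (auto simp: k_def contract_def split: if_splits)
    consider "m a b > 0" | "a = x" "m u b > 0" using kab by (auto simp: k_def contract_def split: if_splits)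
    then have "a \<in> V \<and> b \<in> V \<and> m' b a = 0"
    proof cases
      case 1
      show ?thesis
      proof (cases "(a, b) = (y, x)")
        case True
        then show ?thesis using kxy ne xu yx by (simp add: m'_def k_def[symmetric] cancel_def)
      next
        case False
        then have "b = x \<Longrightarrow> m u a = 0" using tri[of a] 1 by (cases "m u a = 0") auto
        then have "k b a = 0" using goodD(3)[OF g 1] by (auto simp: k_def contract_def)
        then show ?thesis using goodD(1-3)[OF g 1] m'_le[of b a] by auto
      qed
    next
      case 2
      have b: "b \<noteq> x" "b \<in> V" using 2 xu goodD(2)[OF g 2(2)] by auto
      have "b \<noteq> y" using ab 2 kxy by (auto simp: m'_def k_def[symmetric] cancel_def)
      then have "k b a = 0" using 2 b tri[of b] by (simp add: k_def contract_def)
      then show ?thesis using xu 2 b m'_le[of b a] by auto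
    qed
    then show "a \<in> V" "b \<in> V" "m' b a = 0" by auto
  next
    fix w assume w: "w \<in> V"
    show "indeg m' w + outdeg m' w \<le> 5"
    proof (cases "w = x")
      case True
      have "indeg m x > 0" "outdeg m x > 0" using le_indeg[of y m x] le_outdeg[of u m x] yx y xu u by auto
      then show ?thesis using True deg' deg[of x] degu ne d \<open>outdeg m u > 0\<close> by auto
    next
      case False
      then show ?thesis using deg' deg[of w] degu goodD(5)[OF g w] by (cases "w = u") auto
    qed
  qed
  have "num_arcs m' \<le> num_arcs k" using m'_le by (rule num_arcs_mono)
  also have "num_arcs k < num_arcs m" unfolding k_def by (rule num_arcs_contract[OF g u])
  finally show "num_arcs m' < num_arcs m" .
  show "back_bound m (B + 870)" if "back_bound m' B"
    using back_bound_cancel[of x y k B] that kxy y xu yx ne back_bound_contract[OF g u] by (auto simp: m'_def k_def)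
  have "potential m' + (\<Sum>w\<in>{u, x, y}. weight m w) \<le> potential m + (\<Sum>w\<in>{u, x, y}. weight m' w)"
    using xu yx uy deg deg' by (intro potential_diff) (auto simp: weight_def)
  moreover have "weight m' u = 0" using deg' degu ne by (simp add: weight_def)
  moreover have "weight m' x = pot (indeg m x - 1) (outdeg m x + outdeg m u - 2)"
    "weight m' y = pot (indeg m y - 1) (outdeg m y - 1)"
    using deg' deg degu ne by (auto simp: weight_def numeral_2_eq_2)
  ultimately show "potential m' + weight m u + weight m x + weight m y \<le>
       potential m + pot (indeg m x - 1) (outdeg m x + outdeg m u - 2) + pot (indeg m y - 1) (outdeg m y - 1)"
    using ne by simp
qed

end

section \<open>Minimal counterexamples\<close>

locale minimal_counterexample = vertex_set V for V :: "'a set" +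
  fixes m :: "'a \<Rightarrow> 'a \<Rightarrow> nat"
  assumes admissible: "admissible m"
    and smaller: "\<And>m'. admissible m' \<Longrightarrow> num_arcs m' < num_arcs m \<Longrightarrow> back_bound m' (potential m')"
    and counterexample: "\<not> back_bound m (potential m)"
begin

lemma transposed: "minimal_counterexample V (transp m)"
proof
  show "admissible (transp m)" using admissible by (rule admissible_transp)
  show "\<not> back_bound (transp m) (potential (transp m))" using counterexample by (simp add: back_bound_transp)
  show "back_bound m' (potential m')" if "admissible m'" "num_arcs m' < num_arcs (transp m)" for m'
    using smaller that by simp
qed

lemmas arcD = goodD(1-3)[OF admissible]

lemma no_loop [simp]: "m v v = 0"
  using goodD(4)[OF admissible] .

lemma contradiction: "back_bound m B \<Longrightarrow> B \<le> potential m \<Longrightarrow> False"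
  using back_bound_mono counterexample by blast

lemma back_bound_smaller:
  assumes "v \<in> V" "indeg m v > 0 \<or> outdeg m v > 0" "\<And>a b. m' a b \<le> del_vertex v m a b"
  shows "back_bound m' (potential m')"
proof (rule smaller)
  show "admissible m'" using admissible_del[OF admissible] assms(3) by (rule admissible_mono)
  show "num_arcs m' < num_arcs m" using num_arcs_mono[of m' "del_vertex v m", OF assms(3)] num_arcs_del[OF assms(1,2)] by linarith
qed

section \<open>Vertex types that a minimal counterexample avoids\<close>

lemma no_source_or_sink:
  assumes "v \<in> V"
  shows "indeg m v = 0 \<longleftrightarrow> outdeg m v = 0"
proof (rule ccontr)
  assume "\<not> ?thesis"
  then have *: "min (indeg m v) (outdeg m v) = 0" "indeg m v > 0 \<or> outdeg m v > 0" by auto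
  have "back_bound m (potential (del_vertex v m) + 870 * 0)"
    using back_bound_del[OF assms back_bound_smaller[OF assms *(2), of "del_vertex v m"]] unfolding *(1) by simp
  then show False using contradiction[of "potential (del_vertex v m)"] potential_mono[of "del_vertex v m" m] del_le[of v m] by simp
qed

lemma arc_degrees:
  assumes "m a b > 0"
  shows "indeg m a \<ge> 1" "outdeg m a \<ge> 1" "indeg m b \<ge> 1" "outdeg m b \<ge> 1"
proof -
  have "a \<in> V" "b \<in> V" using arcD assms by auto
  then show "indeg m a \<ge> 1" "outdeg m a \<ge> 1" "indeg m b \<ge> 1" "outdeg m b \<ge> 1"
    using le_indeg[of a m b] le_outdeg[of b m a] no_source_or_sink[of a] no_source_or_sink[of b] assms by auto
qed

text \<open>Contract \<open>v\<close> into its predecessor \<open>p\<close>. If the arc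
  \<open>q p\<close> closes a triangle, the resulting 2-cycle is cancelled for 870, and
  \<open>v\<close>, \<open>p\<close>, \<open>q\<close> return at least 290 each.\<close>

lemma not_1_1:
  assumes "v \<in> V"
  shows "(indeg m v, outdeg m v) \<noteq> (1, 1)"
proof
  assume "(indeg m v, outdeg m v) = (1, 1)"
  then have v: "indeg m v = 1" "outdeg m v = 1" by auto
  obtain p where p: "p \<in> V" "m p v > 0" using exists_in[of m v] v by auto
  obtain q where q: "q \<in> V" "m v q > 0" using exists_out[of m v] v by auto
  have q': "w = q" if "m v w > 0" for w
    using le_outd2[of w q m v] q v that arcD(2)[OF that] by (cases "w = q") auto
  have vq: "m v q = 1" using q le_outdeg[of q m v] v by auto
  have valv: "weight m v = 290" using v by (simp add: weight_def)
  show False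
  proof (cases "m q p = 0")
    case True
    have "back_bound (contract v p m) (potential (contract v p m))"
      using q' True v goodD(5)[OF admissible p(1)]
      by (intro smaller admissible_contract[OF admissible v(1) p(2)] num_arcs_contract[OF admissible v(1) p(2)]) auto
    then have "back_bound m (potential (contract v p m))" by (rule back_bound_contract[OF admissible v(1) p(2)])
    note contradiction[OF this]
    moreover have "potential (contract v p m) + weight m v + weight m p \<le> potential m + pot (indeg m p) (outdeg m p + 0)"
      using v by (intro contract_potential[OF admissible v(1) p(2)]) auto
    ultimately show False by (simp add: weight_def)
  next
    case False
    then have qp: "m q p > 0" by simp
    have d: "indeg m p + outdeg m p + outdeg m v \<le> 8" using v goodD(5)[OF admissible p(1)] by simp
    have tri: "m w p = 0" if "w \<noteq> q" "m v w > 0" for w using q' that by auto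
    note f = contract_cancel_facts[OF admissible v(1) p(2) vq qp tri d]
    have "back_bound m (potential (cancel p q (contract v p m)) + 870)" using f(1-3) smaller by blast
    note contradiction[OF this]
    moreover have "pot (indeg m p - 1) (outdeg m p - 1) + 290 \<le> weight m p" 
      unfolding weight_def using arc_degrees[OF qp] goodD(5)[OF admissible] p by (intro pot_drop_11) auto
    moreover have "pot (indeg m q - 1) (outdeg m q - 1) + 290 \<le> weight m q"
      unfolding weight_def using arc_degrees[OF qp] goodD(5)[OF admissible] q by (intro pot_drop_11) auto
    ultimately show False using f(4) v valv by (simp add: numeral_2_eq_2)
  qed
qed

lemma weight_drop:
  assumes "w \<in> V" "indeg m' w + a = indeg m w" "outdeg m' w + b = outdeg m w"
  shows "weight m' w + 38 * (a + b) \<le> weight m w"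
proof (cases "indeg m w = 0")
  case True
  then show ?thesis using no_source_or_sink[OF assms(1)] assms by simp
next
  case False
  then show ?thesis unfolding weight_def
    using no_source_or_sink[OF assms(1)] assms not_1_1[OF assms(1)] goodD(5)[OF admissible assms(1)]
    by (intro pot_drop) auto
qed

lemma weight_drop_321:
  assumes "w \<in> V" "indeg m' w < indeg m w" "outdeg m' w < outdeg m w"
  shows "weight m' w + 321 \<le> weight m w"
  unfolding weight_def
  using assms not_1_1[OF assms(1)] goodD(5)[OF admissible assms(1)] by (intro pot_drop_11) auto

lemma del_potential:
  assumes "v \<in> V"
  shows "potential (del_vertex v m) + weight m v + 38 * (indeg m v + outdeg m v) \<le> potential m"
proof -
  have "(\<Sum>w\<in>V - {v}. weight (del_vertex v m) w + 38 * (m v w + m w v)) \<le> (\<Sum>w\<in>V - {v}. weight m w)"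
    using indeg_del[OF assms, symmetric, of _ m] outdeg_del[OF assms, symmetric, of _ m]
    by (intro sum_mono weight_drop) auto
  moreover have "(\<Sum>w\<in>V - {v}. m v w + m w v) = indeg m v + outdeg m v"
    using indeg_remove[OF assms, of m v] outdeg_remove[OF assms, of m v] by (simp add: sum.distrib)
  then have "(\<Sum>w\<in>V - {v}. weight (del_vertex v m) w + 38 * (m v w + m w v)) =
    (\<Sum>w\<in>V - {v}. weight (del_vertex v m) w) + 38 * (indeg m v + outdeg m v)"
    by (simp only: sum.distrib sum_distrib_left[symmetric])
  moreover have "potential k = weight k v + (\<Sum>w\<in>V - {v}. weight k w)" for k
    unfolding potential_def using assms by (intro sum.remove) auto
  note this[of m] this[of "del_vertex v m"]
  moreover have "weight (del_vertex v m) v = 0" by simp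
  ultimately show ?thesis by linarith
qed

lemma back_bound_del_m:
  assumes "v \<in> V" "indeg m v > 0"
  shows "back_bound m (potential (del_vertex v m) + 870 * min (indeg m v) (outdeg m v))"
  using back_bound_del[OF assms(1) back_bound_smaller[OF assms(1)]] assms by simp

text \<open>Removing \<open>v\<close> would return 720 + 5 * 38 = 910 for a price of 870.\<close>

lemma degree_5_not_1:
  assumes "v \<in> V"
  shows "\<not> (indeg m v + outdeg m v = 5 \<and> min (indeg m v) (outdeg m v) = 1)"
proof
  assume *: "indeg m v + outdeg m v = 5 \<and> min (indeg m v) (outdeg m v) = 1"
  then have "weight m v = 720" by (auto simp: weight_def pot_def min_def split: if_splits)
  moreover have "indeg m v > 0" using * by (auto simp: min_def split: if_splits)
  note contradiction[OF back_bound_del_m[OF assms this]]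
  ultimately show False using del_potential[OF assms] * by simp
qed

lemma types:
  assumes "v \<in> V" "indeg m v > 0"
  shows "indeg m v = 1 \<and> outdeg m v = 2 \<or> indeg m v = 1 \<and> outdeg m v = 3 \<or> indeg m v = 2 \<and> outdeg m v = 1 \<or>
    indeg m v = 2 \<and> outdeg m v = 2 \<or> indeg m v = 2 \<and> outdeg m v = 3 \<or> indeg m v = 3 \<and> outdeg m v = 1 \<or>
    indeg m v = 3 \<and> outdeg m v = 2"
proof -
  have "outdeg m v \<ge> 1" using assms no_source_or_sink[OF assms(1)] by auto
  then have "indeg m v = 1 \<and> outdeg m v = 4 \<longrightarrow> False" "indeg m v = 4 \<and> outdeg m v = 1 \<longrightarrow> False"
    "indeg m v = 1 \<and> outdeg m v = 1 \<longrightarrow> False"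
    using degree_5_not_1[OF assms(1)] not_1_1[OF assms(1)] by auto
  moreover note type_cases[OF goodD(5)[OF admissible assms(1)]]
  ultimately show ?thesis using assms(2) \<open>outdeg m v \<ge> 1\<close> by (metis less_eq_Suc_le One_nat_def)
qed

text \<open>Once \<open>x\<close> is gone, \<open>u\<close> is a source or a sink and goes for
  nothing.\<close>

lemma back_bound_del2:
  assumes "x \<in> V" "u \<in> V" "indeg m x > 0" "indeg (del_vertex x m) u = 0 \<or> outdeg (del_vertex x m) u = 0"
  shows "back_bound m (potential (del_vertex u (del_vertex x m)) + 870 * min (indeg m x) (outdeg m x))"
proof -
  have "back_bound (del_vertex u (del_vertex x m)) (potential (del_vertex u (del_vertex x m)))"
    using assms del_le by (intro back_bound_smaller[of x]) auto
  from back_bound_del[OF assms(2) this] have "back_bound (del_vertex x m) (potential (del_vertex u (del_vertex x m)))" using assms(4) by auto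
  from back_bound_del[OF assms(1) this] show ?thesis by simp
qed

lemma del2_degrees:
  assumes "x \<in> V" "u \<in> V" "x \<noteq> u" "w \<noteq> x" "w \<noteq> u"
  shows "indeg m w = indeg (del_vertex u (del_vertex x m)) w + (m x w + m u w)"
    "outdeg m w = outdeg (del_vertex u (del_vertex x m)) w + (m w x + m w u)"
  using indeg_del[of x w m] outdeg_del[of x w m] indeg_del[of u w "del_vertex x m"] outdeg_del[of u w "del_vertex x m"] assms
  by (auto simp: del_vertex_def)

lemma del2_isolated [simp]: "weight (del_vertex u (del_vertex x m)) u = 0" "weight (del_vertex u (del_vertex x m)) x = 0"
proof -
  show "weight (del_vertex u (del_vertex x m)) u = 0" by simp
  have "indeg (del_vertex u (del_vertex x m)) x = 0" by (simp add: indeg_def del_vertex_def)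
  then show "weight (del_vertex u (del_vertex x m)) x = 0" by simp
qed

lemma del2_le: "del_vertex u (del_vertex x m) a b \<le> m a b"
  by (simp add: del_vertex_def)

section \<open>Triangles and predecessors at vertices with a single in-arc\<close>

lemma weight_nonzero:
  assumes "v \<in> V" "indeg m v > 0"
  shows "weight m v \<ge> 328"
  using types[OF assms] by (auto simp: weight_def)

text \<open>977 = 328 + 328 + 321: \<open>x\<close> and \<open>u\<close> vanish, and
  \<open>w\<close> loses an in-arc from \<open>u\<close> and an out-arc to \<open>x\<close>.\<close>

lemma del2_triangle_potential:
  assumes "m x u > 0" "m u w > 0" "m w x > 0"
  shows "potential (del_vertex u (del_vertex x m)) + 977 \<le> potential m"
proof -
  have V: "x \<in> V" "u \<in> V" "w \<in> V" using assms arcD by blast+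
  have ne: "x \<noteq> u" "u \<noteq> w" "w \<noteq> x" using assms by auto
  let ?k = "del_vertex u (del_vertex x m)"
  have "potential ?k + (\<Sum>v\<in>{x, u, w}. weight m v) \<le> potential m + (\<Sum>v\<in>{x, u, w}. weight ?k v)"
    using V by (intro potential_diff weight_mono del2_le) auto
  moreover have "weight ?k w + 321 \<le> weight m w"
    using del2_degrees[OF V(1,2) ne(1), of w] ne assms by (intro weight_drop_321 V) auto
  moreover have "weight m x \<ge> 328" "weight m u \<ge> 328" using arc_degrees[OF assms(1)] weight_nonzero V by auto
  ultimately show ?thesis using ne by simp
qed

text \<open>If \<open>x\<close> has a single in-arc or a single out-arc, then deleting one arc frees both \<open>x\<close> and \<open>u\<close>.\<close>

lemma no_thin_triangle:
  assumes "indeg m u = 1" "m x u > 0" "m u w > 0" "m w x > 0"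
  shows "indeg m x \<ge> 2" "outdeg m x \<ge> 2"
proof -
  have V: "x \<in> V" "u \<in> V" using assms(2) arcD by auto
  have ne: "x \<noteq> u" using assms(2) by auto
  note d = arc_degrees[OF assms(2)]
  note P = del2_triangle_potential[OF assms(2-4)]
  show "indeg m x \<ge> 2"
  proof (rule ccontr)
    assume "\<not> ?thesis"
    then have "min (indeg m x) (outdeg m x) = 1" "indeg m x > 0" using d by auto
    moreover have "indeg (del_vertex x m) u = 0" using indeg_del[of x u m] V ne assms by auto
    ultimately have "back_bound m (potential (del_vertex u (del_vertex x m)) + 870 * 1)" using back_bound_del2[of x u] V by metis
    from contradiction[OF this] P show False by simp
  qed
  show "outdeg m x \<ge> 2"
  proof (rule ccontr)
    assume "\<not> ?thesis"
    then have "outdeg m x = 1" using d by auto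
    then have "outdeg (del_vertex u m) x = 0" using outdeg_del[of u x m] V ne assms by auto
    moreover have "min (indeg m u) (outdeg m u) = 1" "indeg m u > 0" using assms d by auto
    ultimately have b: "back_bound m (potential (del_vertex x (del_vertex u m)) + 870 * 1)" using back_bound_del2[of u x] V by metis
    have "del_vertex x (del_vertex u m) = del_vertex u (del_vertex x m)" by (auto simp: del_vertex_def fun_eq_iff)
    then show False using contradiction[OF b] P by simp
  qed
qed

text \<open>Otherwise contract \<open>u\<close> into \<open>x\<close>: a vertex of degree 4, of
  weight at most 611, replaces two of weight 328. No triangle interferes, by
  \<open>no_thin_triangle\<close>, since \<open>x\<close> has a single in-arc or a single
  out-arc.\<close>

lemma predecessor_degree:
  assumes "indeg m u = 1" "outdeg m u = 2" "m x u > 0"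
  shows "indeg m x + outdeg m x \<noteq> 3"
proof
  assume d3: "indeg m x + outdeg m x = 3"
  have V: "x \<in> V" "u \<in> V" using assms(3) arcD by auto
  note d = arc_degrees[OF assms(3)]
  have tri: "m w x = 0" if "m u w > 0" for w
    using no_thin_triangle[OF assms(1,3) that] d3 by (cases "m w x = 0") auto
  have "back_bound (contract u x m) (potential (contract u x m))"
    using tri assms d3 by (intro smaller admissible_contract[OF admissible assms(1,3)] num_arcs_contract[OF admissible assms(1,3)]) auto
  then have b: "back_bound m (potential (contract u x m))" by (rule back_bound_contract[OF admissible assms(1,3)])
  moreover have "potential (contract u x m) + weight m u + weight m x \<le> potential m + pot (indeg m x) (outdeg m x + 1)"
    using assms by (intro contract_potential[OF admissible assms(1,3)]) auto
  moreover have "pot (indeg m x) (outdeg m x + 1) \<le> weight m u + weight m x"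
    using types[OF V(1)] d3 assms d by (auto simp: weight_def pot_def)
  ultimately show False using contradiction[OF b] by simp
qed

lemma only_other_out:
  assumes "outdeg m x = 2" "m x u > 0" "m x t > 0" "t \<noteq> u" "m x w > 0" "w \<noteq> u"
  shows "w = t"
proof (rule ccontr)
  assume "w \<noteq> t"
  have V: "u \<in> V" "t \<in> V" "w \<in> V" using assms arcD by blast+
  have "x \<noteq> u" using assms by auto
  then have "outdeg (del_vertex u m) x \<le> 1" using outdeg_del[of u x m] V assms by simp
  moreover have "del_vertex u m x t + del_vertex u m x w \<le> outdeg (del_vertex u m) x" using V \<open>w \<noteq> t\<close> by (intro le_outd2) auto
  ultimately show False using assms \<open>x \<noteq> u\<close> by (simp add: del_vertex_def)
qed

lemma other_out:
  assumes "outdeg m x \<ge> 2" "m x u = 1"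
  obtains t where "t \<noteq> u" "m x t > 0" "t \<in> V"
proof -
  have V: "u \<in> V" "x \<noteq> u" using arcD(2)[of x u] assms by auto
  then have "outdeg (del_vertex u m) x > 0" using outdeg_del[of u x m] assms by simp
  then obtain t where "t \<in> V" "del_vertex u m x t > 0" using exists_out by blast
  then show ?thesis using that by (auto simp: del_vertex_def split: if_splits)
qed

lemma del_degrees:
  assumes "m u w = 1"
  shows "w \<in> V" "w \<noteq> u" "indeg (del_vertex u m) w + 1 = indeg m w" "outdeg (del_vertex u m) w = outdeg m w"
proof -
  show V: "w \<in> V" and ne: "w \<noteq> u" using arcD(2)[of u w] assms by auto
  have "m w u = 0" "u \<in> V" using arcD[of u w] assms by auto
  then show "indeg (del_vertex u m) w + 1 = indeg m w" "outdeg (del_vertex u m) w = outdeg m w"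
    using indeg_del[of u w m] outdeg_del[of u w m] ne assms by auto
qed

lemma double_triangle_outdeg_1:
  assumes u: "indeg m u = 1" "outdeg m u = 2" and x: "indeg m x = 2" "outdeg m x = 2" "m x u > 0"
    and yz: "y \<noteq> z" "m u y > 0" "m u z > 0" "m y x > 0" "m z x > 0" and z: "outdeg m z = 1"
  shows False
proof -
  have V: "x \<in> V" "u \<in> V" "y \<in> V" "z \<in> V" using x yz arcD by blast+
  have ne: "x \<noteq> u" "u \<noteq> y" "u \<noteq> z" "x \<noteq> y" "x \<noteq> z" using x yz by auto
  have uyz: "m u y = 1" "m u z = 1" using le_outd2[of y z m u] u V yz by auto
  have xu1: "m x u = 1" using le_indeg[of x m u] V u x by simp
  have rev: "m y u = 0" "m z u = 0" "m x y = 0" "m x z = 0" "m u x = 0" using arcD(3) x yz by blast+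
  obtain t where t: "t \<noteq> u" "m x t > 0" "t \<in> V" using other_out[of x u] x xu1 by auto
  have tne: "t \<noteq> x" "t \<noteq> y" "t \<noteq> z" using t rev by auto
  have vals: "weight m x = 611" "weight m u = 328" using x u by (auto simp: weight_def pot_def)
  show False
  proof (cases "m t z = 0")
    \<comment> \<open>With an arc \<open>t z\<close>: removing \<open>x\<close> costs two arcs, then
      \<open>u\<close> is a source and \<open>z\<close> a sink. The gain is 611 + 328 + 328 for
      \<open>x\<close>, \<open>u\<close>, \<open>z\<close> and 321 each for \<open>y\<close> and
      \<open>t\<close>, in total 1909 against 1740.\<close>
    case False
    define k where "k = del_vertex u (del_vertex x m)"
    define l where "l = del_vertex z k"
    have deg: "indeg m w = indeg k w + (m x w + m u w)" "outdeg m w = outdeg k w + (m w x + m w u)"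
      if "w \<noteq> x" "w \<noteq> u" for w
      using del2_degrees[OF V(1,2) ne(1) that] by (auto simp: k_def)
    have kz: "outdeg k z = 0" using deg(2)[of z] ne z yz by simp
    have "back_bound l (potential l)" using V x del_le by (intro back_bound_smaller[of x]) (auto simp: l_def k_def del_vertex_def)
    from back_bound_del[OF V(4) this[unfolded l_def]] have "back_bound k (potential l)" using kz by (simp add: l_def)
    from back_bound_del[OF V(2) this[unfolded k_def]] have "back_bound (del_vertex x m) (potential l)"
      using indeg_del[of x u m] V ne xu1 u by simp
    from back_bound_del[OF V(1) this] have b: "back_bound m (potential l + 1740)" using x by simp
    have "potential l + (\<Sum>v\<in>{x, u, y, z, t}. weight m v) \<le> potential m + (\<Sum>v\<in>{x, u, y, z, t}. weight l v)"
      using V t by (intro potential_diff weight_mono) (auto simp: l_def k_def del_vertex_def)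
    moreover have "weight l z = 0" by (simp add: l_def)
    moreover have "indeg l x = 0" "indeg l u = 0" by (auto simp: l_def k_def indeg_def del_vertex_def)
    then have "weight l x = 0" "weight l u = 0" by auto
    moreover have le: "indeg l w \<le> indeg k w" "outdeg l w \<le> outdeg k w" for w
      unfolding l_def by (intro indeg_mono outdeg_mono del_le)+
    have "weight l y + 321 \<le> weight m y"
      using deg[of y] le[of y] ne uyz yz by (intro weight_drop_321 V) auto
    moreover have "weight l t + 321 \<le> weight m t"
    proof (intro weight_drop_321 t)
      show "indeg l t < indeg m t" using deg(1)[of t] le(1)[of t] t tne by simp
      have "k t z = m t z" using t tne ne by (simp add: k_def del_vertex_def)
      then have "outdeg l t < outdeg k t" using outdeg_del[of z t k] V tne False by (simp add: l_def)
      then show "outdeg l t < outdeg m t" using deg(2)[of t] t tne by simp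
    qed
    moreover have "weight m z \<ge> 328" using weight_nonzero V arc_degrees[OF yz(5)] by simp
    ultimately show False using contradiction[OF b] vals ne tne t yz by simp
  next
    \<comment> \<open>Without an arc \<open>t z\<close>: removing \<open>u\<close> costs one arc and
      leaves \<open>z x\<close> as the only out-arc of \<open>z\<close>, so \<open>z\<close> is
      contracted into \<open>x\<close> in the transpose. The merged vertex has the type that
      \<open>z\<close> had in \<open>m\<close>, so the weights 611 of \<open>x\<close> and 328 of
      \<open>u\<close> are gained.\<close>
    case True
    define k where "k = del_vertex u m"
    define l where "l = contract z x (transp k)"
    have deg: "indeg k x = 2" "outdeg k x = 1" "outdeg k z = 1" "indeg m z = indeg k z + 1"
      using indeg_del[of u x m] outdeg_del[of u x m] del_degrees[OF uyz(2)] V ne rev xu1 x z by (auto simp: k_def)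
    have "indeg m z \<le> 3" "indeg m z \<ge> 2" using types[OF V(4)] arc_degrees[OF yz(5)] z by auto
    then obtain j where j: "indeg k z = Suc j" "indeg m z = j + 2" "j \<le> 1" using deg(4) by (cases "indeg k z") auto
    have gk: "admissible (transp k)" unfolding k_def by (intro admissible_transp admissible_del admissible)
    have pz: "indeg (transp k) z = 1" "transp k x z > 0"
      using deg yz ne by (auto simp: k_def del_vertex_def transp_apply)
    have "admissible l" unfolding l_def
    proof (rule admissible_contract[OF gk pz])
      fix w assume w: "transp k z w > 0"
      then have "m w z > 0" "w \<noteq> u" by (auto simp: k_def del_vertex_def transp_apply split: if_splits)
      then have "m x w = 0" using only_other_out[OF x(2,3) t(2,1), of w] True by (cases "m x w = 0") auto
      then show "transp k w x = 0" by (simp add: k_def del_vertex_def transp_apply)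
    next
      show "indeg (transp k) x + outdeg (transp k) x + outdeg (transp k) z \<le> 6"
        unfolding indeg_transp outdeg_transp using deg j by linarith
    qed
    moreover have "num_arcs l < num_arcs m"
      using num_arcs_contract[OF gk pz] num_arcs_del[of u m] V u by (simp add: l_def k_def)
    ultimately have "back_bound (transp k) (potential l)" using smaller back_bound_contract[OF gk pz] by (simp add: l_def)
    then have "back_bound k (potential l)" by (simp add: back_bound_transp)
    from back_bound_del[OF V(2) this[unfolded k_def]] have b: "back_bound m (potential l + 870)" using u by simp
    have "potential l + weight k z + weight k x \<le> potential k + pot 1 (2 + j)"
      using contract_potential[OF gk pz, of j] j deg by (simp add: l_def)
    moreover have "pot 1 (2 + j) = weight m z" using j z by (simp add: weight_def pot_commute add.commute)
    moreover have "potential k + (\<Sum>v\<in>{u, x, y, z}. weight m v) \<le> potential m + (\<Sum>v\<in>{u, x, y, z}. weight k v)"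
      using V unfolding k_def by (intro potential_diff weight_mono del_le) auto
    moreover have "weight k u = 0" by (simp add: k_def)
    moreover have "weight k y + 38 * (1 + 0) \<le> weight m y"
      using del_degrees[OF uyz(1)] V by (intro weight_drop) (auto simp: k_def)
    ultimately show False using contradiction[OF b] vals ne yz by simp
  qed
qed

text \<open>Ensures that at least one out-neighbour of \<open>u\<close> can be charged with its
  deficit. By \<open>no_thin_triangle\<close>, \<open>x\<close> has in- and out-degree at least 2,
  so its type is (2, 2), (2, 3) or (3, 2).\<close>

lemma no_double_triangle:
  assumes u: "indeg m u = 1" "outdeg m u = 2" "m x u > 0"
    and yz: "y \<noteq> z" "m u y > 0" "m u z > 0" "m y x > 0" 
  shows "m z x = 0"
proof (rule ccontr)
  assume "m z x \<noteq> 0"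
  then have zx: "m z x > 0" by simp
  have V: "x \<in> V" "u \<in> V" "y \<in> V" "z \<in> V" using u yz arcD by blast+
  have ne: "x \<noteq> u" "u \<noteq> y" "u \<noteq> z" "x \<noteq> y" "x \<noteq> z" using u yz zx by auto
  have uyz: "m u y = 1" "m u z = 1" using le_outd2[of y z m u] u V yz by auto
  have xu1: "m x u = 1" using le_indeg[of x m u] V u by simp
  have rev: "m y u = 0" "m z u = 0" "m x y = 0" "m x z = 0" "m u x = 0" using arcD(3) u yz zx by blast+
  have vu: "weight m u = 328" using u by (auto simp: weight_def pot_def)
  have x2: "indeg m x \<ge> 2" "outdeg m x \<ge> 2" using no_thin_triangle[OF u(1,3) yz(2,4)] by auto
  then have x3: "indeg m x \<le> 3" "outdeg m x \<le> 3" "indeg m x + outdeg m x = 4 \<or> indeg m x + outdeg m x = 5"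
    using types[OF V(1)] by auto
  define k where "k = del_vertex u (del_vertex x m)"
  have deg: "indeg m w = indeg k w + (m x w + m u w)" "outdeg m w = outdeg k w + (m w x + m w u)"
    if "w \<noteq> x" "w \<noteq> u" for w
    using del2_degrees[OF V(1,2) ne(1) that] by (auto simp: k_def)
  have "back_bound m (potential k + 870 * min (indeg m x) (outdeg m x))"
    unfolding k_def using indeg_del[of x u m] V ne u xu1 x2 by (intro back_bound_del2) auto
  moreover have "min (indeg m x) (outdeg m x) = 2" using x2 x3 by auto
  ultimately have b: "back_bound m (potential k + 1740)" by simp
  have not12: "\<not> (indeg m w = 1 \<and> outdeg m w = 2)" if "m u w > 0" for w
    using predecessor_degree[of w u] that u by auto
  show False
  proof (cases "indeg m x + outdeg m x = 5")
    \<comment> \<open>Removing \<open>x\<close> and then the source \<open>u\<close> costs 1740 and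
      returns 720 + 328 + 6 * 38 + 2 * 245 = 1766.\<close>
    case True
    then have vx: "weight m x = 720" using x2 x3 by (auto simp: weight_def pot_def)
    have yx3: "m y x + m z x \<le> 3" using le_ind2[of y z m x] V yz x3 by simp
    have special: "weight k w + 38 * (m x w + m u w + (m w x + m w u)) + 245 \<le> weight m w"
      if "w = y \<or> w = z" for w
    proof -
      have w: "w \<in> V" "w \<noteq> x" "w \<noteq> u" "m u w = 1" "m x w = 0" "m w u = 0" "m w x = 1 \<or> m w x = 2"
        "\<not> (indeg m w = 1 \<and> outdeg m w = 2)"
        using that V ne uyz rev yz zx yx3 not12 by auto
      then have d: "indeg k w = indeg m w - 1" "outdeg k w = outdeg m w - m w x" "indeg m w \<ge> 1" "outdeg m w \<ge> m w x"
        using deg[of w] by auto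
      show ?thesis
        using pot_drop_12[OF _ w(7) d(4), of "indeg m w"] types[OF w(1)] d(3) w(8)
        unfolding weight_def d(1,2) w(4-6) by (auto simp del: pot_table)
    qed
    have "(\<Sum>w\<in>V - {x, u}. weight k w + 38 * (m x w + m u w + (m w x + m w u)) + (if w \<in> {y, z} then 245 else 0))
      \<le> (\<Sum>w\<in>V - {x, u}. weight m w)"
    proof (intro sum_mono)
      fix w assume w: "w \<in> V - {x, u}"
      show "weight k w + 38 * (m x w + m u w + (m w x + m w u)) + (if w \<in> {y, z} then 245 else 0) \<le> weight m w"
      proof (cases "w \<in> {y, z}")
        case True
        then show ?thesis using special[of w] by auto
      next
        case False
        have "weight k w + 38 * (m x w + m u w + (m w x + m w u)) \<le> weight m w"
          using deg[of w] w by (intro weight_drop) auto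
        with False show ?thesis by simp
      qed
    qed
    \<comment> \<open>Degrees 5 and 3, minus both ends of the arc \<open>x u\<close>.\<close>
    moreover have "(\<Sum>w\<in>V - {x, u}. m x w + m u w + (m w x + m w u)) = 6"
    proof -
      have split: "(\<Sum>w\<in>V. f w) = f x + f u + (\<Sum>w\<in>V - {x, u}. f w)" for f :: "'a \<Rightarrow> nat"
        using V ne sum.subset_diff[of "{x,u}" V f] by simp
      have "outdeg m x = 1 + (\<Sum>w\<in>V - {x, u}. m x w)" "indeg m x = (\<Sum>w\<in>V - {x, u}. m w x)"
        "outdeg m u = (\<Sum>w\<in>V - {x, u}. m u w)" "indeg m u = 1 + (\<Sum>w\<in>V - {x, u}. m w u)"
        unfolding indeg_def outdeg_def by (subst split, simp add: rev xu1)+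
      then show ?thesis using True u by (simp add: sum.distrib)
    qed
    moreover have "(\<Sum>w\<in>V - {x, u}. (if w \<in> {y, z} then 245 else 0)) = (490::nat)"
    proof -
      have "(\<Sum>w\<in>V - {x, u}. (if w \<in> {y, z} then 245 else 0)) = (\<Sum>w\<in>{y, z}. 245::nat)"
        using V ne yz by (intro sum.mono_neutral_cong_right) auto
      then show ?thesis using yz by simp
    qed
    ultimately have "(\<Sum>w\<in>V - {x, u}. weight k w) + 718 \<le> (\<Sum>w\<in>V - {x, u}. weight m w)"
      unfolding sum.distrib sum_distrib_left[symmetric] by simp
    moreover have "potential l = weight l x + weight l u + (\<Sum>w\<in>V - {x, u}. weight l w)" for l
      unfolding potential_def using V ne sum.subset_diff[of "{x,u}" V "weight l"] by simp
    note this[of k] this[of m]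
    ultimately show False using contradiction[OF b] vx vu by (simp add: k_def)
  next
    case False
    then have x: "indeg m x = 2" "outdeg m x = 2" using x2 x3 by auto
    have vx: "weight m x = 611" using x by (auto simp: weight_def pot_def)
    have o1: "outdeg m z \<noteq> 1" "outdeg m y \<noteq> 1"
      using double_triangle_outdeg_1[OF u(1,2) x u(3) yz(1-4) zx]
        double_triangle_outdeg_1[OF u(1,2) x u(3) yz(1)[symmetric] yz(3,2) zx yz(4)] by auto
    \<comment> \<open>Removing \<open>u\<close> alone costs 870 and returns 328 at \<open>u\<close>
      and 611 - 328 = 283 at \<open>x\<close>. A drop of 259 at \<open>y\<close> or \<open>z\<close>
      would pay the rest, so both must have type (3, 2).\<close>
    define d where "d = del_vertex u m"
    have big: "indeg m w = 3 \<and> outdeg m w = 2 \<and> weight m w = 720 \<or> weight d w + 259 \<le> weight m w"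
      if "m u w = 1" "outdeg m w \<noteq> 1" for w
    proof -
      note w = del_degrees[OF that(1), folded d_def]
      then have "indeg d w = indeg m w - 1" "indeg m w > 0" by auto
      then show ?thesis using types[OF w(1)] that pot_drop_in[of "indeg m w" "outdeg m w"] unfolding weight_def w(4)
        by (auto simp del: pot_table)
    qed
    have "potential d + (\<Sum>v\<in>{u, x, y, z}. weight m v) \<le> potential m + (\<Sum>v\<in>{u, x, y, z}. weight d v)"
      using V unfolding d_def by (intro potential_diff weight_mono del_le) auto
    moreover have "weight d u = 0" by (simp add: d_def)
    moreover have "indeg d x = 2" "outdeg d x = 1"
      using indeg_del[of u x m] outdeg_del[of u x m] V ne rev xu1 x by (auto simp: d_def)
    then have "weight d x = 328" by (simp add: weight_def pot_def)
    moreover have "back_bound m (potential d + 870)" using back_bound_del_m[of u] V u by (simp add: d_def)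
    note contradiction[OF this]
    moreover have "weight d y \<le> weight m y" "weight d z \<le> weight m z" unfolding d_def by (intro weight_mono del_le)+
    ultimately have "\<not> weight d y + 259 \<le> weight m y" "\<not> weight d z + 259 \<le> weight m z"
      using vx vu ne yz by auto
    then have yz32: "indeg m y = 3" "outdeg m y = 2" "weight m y = 720" "indeg m z = 3" "outdeg m z = 2" "weight m z = 720"
      using big[of y] big[of z] uyz o1 by auto
    obtain t where t: "t \<noteq> u" "m x t > 0" "t \<in> V" using other_out[of x u] x xu1 by auto
    have tne: "t \<noteq> x" "t \<noteq> y" "t \<noteq> z" using t rev by auto
    \<comment> \<open>Removing \<open>x\<close> and \<open>u\<close> now returns 611 + 328 + 2 *
      (720 - 328) + 38 = 1761 against 1740, the 38 coming from \<open>t\<close>.\<close>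
    have "potential k + (\<Sum>v\<in>{x, u, y, z, t}. weight m v) \<le> potential m + (\<Sum>v\<in>{x, u, y, z, t}. weight k v)"
      unfolding k_def using V t by (intro potential_diff weight_mono del2_le) auto
    moreover have "weight k x = 0" "weight k u = 0" by (auto simp: k_def)
    moreover have "weight k w \<le> 328" if "w = y \<or> w = z" for w
    proof -
      have "indeg k w \<le> 2" "outdeg k w \<le> 1" using that deg[of w] ne yz zx uyz yz32 by auto
      then have "weight k w \<le> pot 2 1" unfolding weight_def by (rule pot_mono)
      then show ?thesis by (simp add: pot_def)
    qed
    note this[of y] this[of z]
    moreover have "weight k t + 38 * (m x t + m u t + (m t x + m t u)) \<le> weight m t"
      using deg[of t] t tne by (intro weight_drop) auto
    ultimately show False using contradiction[OF b] vx vu ne yz t tne yz32 by simp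
  qed
qed

text \<open>Needed to halve the charges in \<open>share_le_2_3\<close>. If \<open>x\<close> has
  out-degree 2, removing \<open>u\<close> returns at least 328 + 283 + 347. Otherwise
  \<open>x\<close> has type (2, 3), and contracting and cancelling replaces 328 + 720 + 720 by 373 +
  328; both gains exceed 870.\<close>

lemma no_2_3_triangle:
  assumes u: "indeg m u = 1" "outdeg m u = 2" "m x u > 0"
    and yz: "y \<noteq> z" "m u y > 0" "m u z > 0" "m y x > 0" 
  shows "\<not> (indeg m y = 2 \<and> outdeg m y = 3)"
proof
  assume y: "indeg m y = 2 \<and> outdeg m y = 3"
  have zx: "m z x = 0" using no_double_triangle[OF u yz] .
  have V: "x \<in> V" "u \<in> V" "y \<in> V" "z \<in> V" using u yz arcD by blast+
  have ne: "x \<noteq> u" "u \<noteq> y" "x \<noteq> y" using u yz by auto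
  have uyz: "m u y = 1" "m u z = 1" using le_outd2[of y z m u] u V yz by auto
  have xu1: "m x u = 1" using le_indeg[of x m u] V u by simp
  have rev: "m y u = 0" "m x y = 0" "m u x = 0" using arcD(3) u yz by blast+
  have x2: "indeg m x \<ge> 2" "outdeg m x \<ge> 2" using no_thin_triangle[OF u(1,3) yz(2,4)] by auto
  have vals: "weight m u = 328" "weight m y = 720" using u y by (auto simp: weight_def pot_def)
  show False
  proof (cases "outdeg m x = 2")
    case True
    define d where "d = del_vertex u m"
    have "potential d + (\<Sum>v\<in>{u, x, y}. weight m v) \<le> potential m + (\<Sum>v\<in>{u, x, y}. weight d v)"
      using V unfolding d_def by (intro potential_diff weight_mono del_le) auto
    moreover have "weight d u = 0" by (simp add: d_def)
    moreover have "indeg d x = indeg m x" "outdeg d x = 1"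
      using indeg_del[of u x m] outdeg_del[of u x m] V ne rev xu1 True by (auto simp: d_def)
    then have "weight d x + 283 \<le> weight m x"
      unfolding weight_def using types[OF V(1)] x2 True by (auto simp: pot_def)
    moreover have "indeg d y = 1" "outdeg d y = 3"
      using del_degrees[OF uyz(1)] y by (auto simp: d_def)
    then have "weight d y = 373" by (simp add: weight_def pot_def)
    moreover have "back_bound m (potential d + 870)" using back_bound_del_m[of u] V u by (simp add: d_def)
    note contradiction[OF this]
    ultimately show False using vals ne by simp
  next
    case False
    then have x: "indeg m x = 2" "outdeg m x = 3" using types[OF V(1)] x2 by auto
    have tri: "m w x = 0" if "w \<noteq> y" "m u w > 0" for w
      using only_other_out[OF u(2) yz(2,3) yz(1)[symmetric] that(2,1)] zx by simp
    have "indeg m x + outdeg m x + outdeg m u \<le> 8" using x u by simp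
    note f = contract_cancel_facts[OF admissible u(1,3) uyz(1) yz(4) tri this]
    have "back_bound m (potential (cancel x y (contract u x m)) + 870)" using f(1-3) smaller by blast
    note contradiction[OF this]
    then show False using f(4) vals x u y by (simp add: weight_def pot_def)
  qed
qed

end

section \<open>Averaging over vertex removals\<close>

context vertex_set
begin

definition free :: "('a \<Rightarrow> 'a \<Rightarrow> nat) \<Rightarrow> 'a \<Rightarrow> 'a \<Rightarrow> 'a \<Rightarrow> bool" where
  "free m n p q \<longleftrightarrow> indeg m n = 1 \<and> outdeg m n = 1 \<and> m p n > 0 \<and> m n q > 0 \<and> m q p = 0"

lemma free_unique:
  assumes "admissible m" "free m n p q"
  shows "m w n > 0 \<Longrightarrow> w = p" "m n w > 0 \<Longrightarrow> w = q"
proof -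
  have V: "p \<in> V" "q \<in> V" using assms goodD(1,2) by (auto simp: free_def)
  show "w = p" if "m w n > 0"
    using le_ind2[of w p m n] V goodD(1)[OF assms(1) that] that assms(2) by (auto simp: free_def)
  show "w = q" if "m n w > 0"
    using le_outd2[of w q m n] V goodD(2)[OF assms(1) that] that assms(2) by (auto simp: free_def)
qed

lemma contract_free:
  assumes g: "admissible m" and f: "free m n p q"
  shows "admissible (contract n p m)" "num_arcs (contract n p m) < num_arcs m" "potential (contract n p m) + 290 \<le> potential m"
    "back_bound (contract n p m) B \<Longrightarrow> back_bound m B"
proof -
  have n: "indeg m n = 1" "m p n > 0" "outdeg m n = Suc 0" using f by (auto simp: free_def)
  have "p \<in> V" using goodD(1)[OF g n(2)] .
  have "m w p = 0" if "m n w > 0" for w using free_unique(2)[OF assms that] f by (auto simp: free_def)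
  then show "admissible (contract n p m)" using n goodD(5)[OF g \<open>p \<in> V\<close>] by (intro admissible_contract[OF g n(1,2)]) auto
  show "num_arcs (contract n p m) < num_arcs m" by (rule num_arcs_contract[OF g n(1,2)])
  show "back_bound m B" if "back_bound (contract n p m) B" using back_bound_contract[OF g n(1,2) that] .
  have "weight m n = 290" using n by (simp add: weight_def)
  then show "potential (contract n p m) + 290 \<le> potential m"
    using contract_potential[OF g n(1,2), of 0] n by (simp add: weight_def)
qed

text \<open>Contracting \<open>n\<close> creates the arc \<open>p q\<close>, which could close a
  triangle through \<open>n'\<close> only if \<open>q = p'\<close> and
  \<open>q' = p\<close>.\<close>

lemma free_contract:
  assumes g: "admissible m" and f: "free m n p q" "free m n' p' q'" and ne: "n \<noteq> n'"
    and adj: "m n n' = 0" "m n' n = 0" and "\<not> (q = p' \<and> q' = p)"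
  shows "free (contract n p m) n' p' q'"
proof -
  have n: "indeg m n = 1" "m p n > 0" "m n q > 0" and n': "m p' n' > 0" "m n' q' > 0" "m q' p' = 0"
    using f by (auto simp: free_def)
  have d: "p \<noteq> n'" "p' \<noteq> n" "q' \<noteq> n" using n n' adj by auto
  have "indeg (contract n p m) n' = 1" "outdeg (contract n p m) n' = 1"
    using contract_degrees(1,2)[OF g n(1,2), of n'] ne d f by (auto simp: free_def)
  moreover have "contract n p m p' n' > 0" "contract n p m n' q' > 0"
    using d ne n' by (auto simp: contract_def)
  moreover have "contract n p m q' p' = 0"
  proof (cases "q' = p")
    case True
    then have "m n p' = 0" using free_unique(2)[OF g f(1), of p'] assms(7) by (cases "m n p' = 0") auto
    then show ?thesis using n' True by (simp add: contract_def)
  next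
    case False
    then show ?thesis using n' by (simp add: contract_def)
  qed
  ultimately show ?thesis by (simp add: free_def)
qed

text \<open>A doubled arc to \<open>v\<close> is excluded: its removal makes \<open>u\<close> a
  sink, the full 328 drops, and no deficit arises.\<close>

definition slack_at :: "('a \<Rightarrow> 'a \<Rightarrow> nat) \<Rightarrow> 'a \<Rightarrow> 'a \<Rightarrow> bool" where
  "slack_at m u v \<longleftrightarrow> indeg m u = 1 \<and> outdeg m u = 2 \<and> m u v = 1 \<and>
     (\<forall>x z. m x u > 0 \<longrightarrow> m u z > 0 \<longrightarrow> z \<noteq> v \<longrightarrow> m z x = 0)"

text \<open>
  If \<open>slack_at m u v\<close>, then removing \<open>v\<close> makes \<open>u\<close> contractible. The deficit of a vertex \<open>u\<close> of type
  \<open>(1, 2)\<close> in the averaging is \<open>870 - 2 * 328 - 2 * (328 - 290) = 138\<close>; it is charged to the one or two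
  such \<open>v\<close>.
\<close>

definition share :: "('a \<Rightarrow> 'a \<Rightarrow> nat) \<Rightarrow> 'a \<Rightarrow> 'a \<Rightarrow> nat" where
  "share m u v = (if slack_at m u v then if \<exists>z. z \<noteq> v \<and> slack_at m u z then 69 else 138 else 0)"

lemma transp_del: "transp (del_vertex v m) = del_vertex v (transp m)"
  by (auto simp: transp_def del_vertex_def fun_eq_iff)

lemma free_transp: "free (transp m) n q p \<longleftrightarrow> free m n p q"
  by (auto simp: free_def transp_apply)

end

context minimal_counterexample
begin

lemma slack_free:
  assumes "slack_at m u v"
  obtains p q where "free (del_vertex v m) u p q" "indeg m p + outdeg m p \<noteq> 3" "m p u > 0" "m u q > 0" "q \<noteq> v"
proof -
  have u: "indeg m u = 1" "outdeg m u = 2" "m u v = 1" using assms by (auto simp: slack_at_def)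
  obtain p where p: "m p u > 0" using exists_in[of m u] u by auto
  obtain q where q: "q \<noteq> v" "m u q > 0" using other_out[of u v] u by auto
  have "v \<in> V" "u \<noteq> v" "m v u = 0" using u arcD[of u v] by auto
  then have "indeg (del_vertex v m) u = 1" "outdeg (del_vertex v m) u = 1"
    using indeg_del[of v u m] outdeg_del[of v u m] u by auto
  moreover have "m q p = 0" using assms p q by (auto simp: slack_at_def)
  moreover have "p \<noteq> v" using p u arcD(3)[of p u] by auto
  ultimately have "free (del_vertex v m) u p q" using p q \<open>u \<noteq> v\<close> by (simp add: free_def del_vertex_def)
  moreover have "indeg m p + outdeg m p \<noteq> 3" using predecessor_degree[OF u(1,2) p] .
  ultimately show ?thesis using that p q by blast
qed

text \<open>
  Two non-adjacent free vertices can be contracted one after the other unless they are opposite in a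
  directed 4-cycle; this cannot happen for all pairs among three vertices, since the in-neighbours
  of \<open>a\<close> and \<open>b\<close> do not have degree 3.
\<close>

lemma two_free:
  assumes "slack_at m a v" "slack_at m b v" "a \<noteq> b" "c \<noteq> a" "c \<noteq> b"
    and c: "free (del_vertex v m) c pc qc" "indeg m c + outdeg m c = 3"
  shows "\<exists>n p q n' p' q'. free (del_vertex v m) n p q \<and> free (del_vertex v m) n' p' q' \<and> n \<noteq> n' \<and>
    del_vertex v m n n' = 0 \<and> del_vertex v m n' n = 0 \<and> \<not> (q = p' \<and> q' = p)"
proof -
  let ?k = "del_vertex v m"
  note g = admissible_del[OF admissible, of v]
  obtain pa qa where a: "free ?k a pa qa" "indeg m pa + outdeg m pa \<noteq> 3" using slack_free[OF assms(1)] by metis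
  obtain pb qb where b: "free ?k b pb qb" "indeg m pb + outdeg m pb \<noteq> 3" using slack_free[OF assms(2)] by metis
  have da: "indeg m a + outdeg m a = 3" and db: "indeg m b + outdeg m b = 3"
    using assms(1,2) by (auto simp: slack_at_def)
  have "\<not> ?k a b > 0" "\<not> ?k b a > 0"
    using free_unique(1)[OF g b(1), of a] free_unique(1)[OF g a(1), of b] a(2) b(2) da db by auto
  then have ab: "?k a b = 0" "?k b a = 0" by auto
  show ?thesis
  proof (cases "qa = pb \<and> qb = pa")
    case False
    then show ?thesis using a(1) b(1) ab assms(3) by blast
  next
    case True
    have "\<not> ?k a c > 0" "\<not> ?k c a > 0"
      using free_unique(2)[OF g a(1), of c] free_unique(1)[OF g a(1), of c] a(2) b(2) c(2) True by auto
    then have ac: "?k a c = 0" "?k c a = 0" by auto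
    have "\<not> ?k b c > 0" "\<not> ?k c b > 0"
      using free_unique(2)[OF g b(1), of c] free_unique(1)[OF g b(1), of c] a(2) b(2) c(2) True by auto
    then have bc: "?k b c = 0" "?k c b = 0" by auto
    have "qa \<noteq> pa"
    proof
      assume "qa = pa"
      then have "?k a pa > 0" "?k pa a > 0" using a(1) by (auto simp: free_def)
      then show False using goodD(3)[OF g] by fastforce
    qed
    then have "\<not> (qa = pc \<and> qc = pa) \<or> \<not> (qb = pc \<and> qc = pb)" using True by auto
    then show ?thesis using a(1) b(1) c(1) ac bc assms(4,5) by blast
  qed
qed

text \<open>The charges on \<open>v\<close> from its in-neighbours of type (1, 2) and, through the
  transpose, from its out-neighbours of type (2, 1).\<close>

definition bonus :: "'a \<Rightarrow> nat" where
  "bonus v = (\<Sum>u\<in>V. share m u v + share (transp m) u v)"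

lemma slack_in_V: "slack_at m u v \<Longrightarrow> u \<in> V \<and> v \<in> V"
  using arcD(1,2)[of u v] by (auto simp: slack_at_def)

lemma share_le: "share m u v \<le> 138 * m u v"
  by (auto simp: share_def slack_at_def)

text \<open>By \<open>no_2_3_triangle\<close> there is no arc from \<open>v\<close> to the
  predecessor of \<open>u\<close>; hence the other out-neighbour \<open>q\<close> is charged as well
  and takes half.\<close>

lemma share_le_2_3:
  assumes "indeg m v = 2" "outdeg m v = 3"
  shows "share m u v \<le> 69 * m u v"
proof (cases "slack_at m u v")
  case True
  then have u: "indeg m u = 1" "outdeg m u = 2" "m u v = 1" by (auto simp: slack_at_def)
  obtain p q where pq: "m p u > 0" "m u q > 0" "q \<noteq> v" using slack_free[OF True] by metis
  have "m v p = 0"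
    using no_2_3_triangle[OF u(1,2) pq(1) pq(3)[symmetric] _ pq(2)] u assms by (cases "m v p = 0") auto
  have V: "q \<in> V" "v \<in> V" "p \<in> V" using arcD pq True slack_in_V by blast+
  then have "m u q = 1" using le_outd2[of q v m u] pq u by auto
  moreover have "m z x = 0" if "m x u > 0" "m u z > 0" "z \<noteq> q" for x z
  proof -
    have "x = p" using le_ind2[of x p m u] that V u pq arcD(1)[OF that(1)] by (cases "x = p") auto
    moreover have "z = v" using only_other_out[OF u(2) pq(2) _ pq(3)[symmetric] that(2,3)] u by simp
    ultimately show ?thesis using \<open>m v p = 0\<close> by simp
  qed
  ultimately have "slack_at m u q" using u by (auto simp: slack_at_def)
  then show ?thesis using True pq u by (auto simp: share_def)
qed (simp add: share_def)

lemma sum_share_le: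
  shows "(\<Sum>u\<in>V. share m u v) \<le> 138 * indeg m v"
    and "indeg m v = 2 \<Longrightarrow> outdeg m v = 3 \<Longrightarrow> (\<Sum>u\<in>V. share m u v) \<le> 69 * indeg m v"
  unfolding indeg_def sum_distrib_left
  by (intro sum_mono share_le, intro sum_mono share_le_2_3) (auto simp: indeg_def)

text \<open>552 = 4 * 138 covers degree at most 4. Type (2, 3) also gives 2 * 69 + 3 * 138 = 552,
  and (3, 2) is its transpose.\<close>

lemma bonus_le_552:
  assumes "v \<in> V"
  shows "bonus v \<le> 552"
proof (cases "indeg m v = 0")
  case True
  then show ?thesis using sum_share_le(1)[of v] minimal_counterexample.sum_share_le(1)[OF transposed, of v]
      no_source_or_sink[OF assms] by (simp add: bonus_def sum.distrib)
next
  case False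
  then show ?thesis using types[OF assms] sum_share_le[of v] 
      minimal_counterexample.sum_share_le[OF transposed, of v]
    unfolding bonus_def sum.distrib indeg_transp outdeg_transp by auto
qed

lemma share_le_138: "share k u v \<le> (if slack_at k u v then 138 else 0)"
  by (simp add: share_def)

lemma bonus_le_card:
  "bonus v \<le> 138 * card {u\<in>V. slack_at m u v \<or> slack_at (transp m) u v}" (is "_ \<le> 138 * card ?N")
proof -
  have "share m u v + share (transp m) u v \<le> (if slack_at m u v \<or> slack_at (transp m) u v then 138 else 0)" for u
  proof -
    have "\<not> (slack_at m u v \<and> slack_at (transp m) u v)" by (simp add: slack_at_def)
    then show ?thesis using share_le_138[of m u v] share_le_138[of "transp m" u v] by (auto split: if_splits)
  qed
  then have "bonus v \<le> (\<Sum>u\<in>V. if slack_at m u v \<or> slack_at (transp m) u v then 138 else 0)"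
    unfolding bonus_def by (intro sum_mono)
  also have "\<dots> = (\<Sum>u\<in>?N. 138)" by (intro sum.mono_neutral_cong_right) auto
  finally show ?thesis by simp
qed

lemma slack_free_any:
  assumes "slack_at m u v \<or> slack_at (transp m) u v"
  shows "\<exists>p q. free (del_vertex v m) u p q" "indeg m u + outdeg m u = 3"
proof -
  show "\<exists>p q. free (del_vertex v m) u p q"
    using assms slack_free minimal_counterexample.slack_free[OF transposed]
    by (metis free_transp transp_del)
  show "indeg m u + outdeg m u = 3" using assms by (auto simp: slack_at_def)
qed

text \<open>Among three charging vertices two have the same orientation; \<open>two_free\<close>
  takes these and any third.\<close>

lemma two_free_any:
  assumes "card {u\<in>V. slack_at m u v \<or> slack_at (transp m) u v} \<ge> 3"
  shows "\<exists>n p q n' p' q'. free (del_vertex v m) n p q \<and> free (del_vertex v m) n' p' q' \<and> n \<noteq> n' \<and>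
    del_vertex v m n n' = 0 \<and> del_vertex v m n' n = 0 \<and> \<not> (q = p' \<and> q' = p)"
proof -
  obtain T where T: "T \<subseteq> {u\<in>V. slack_at m u v \<or> slack_at (transp m) u v}" "card T = 3"
    using obtain_subset_with_card_n[OF assms] by blast
  then obtain a b c where abc: "T = {a, b, c}" "a \<noteq> b" "b \<noteq> c" "a \<noteq> c" by (auto simp: card_3_iff)
  have S: "slack_at m w v \<or> slack_at (transp m) w v" if "w \<in> {a, b, c}" for w using that T abc by auto
  have m_case: ?thesis if "slack_at m a' v" "slack_at m b' v" "a' \<noteq> b'" "c' \<noteq> a'" "c' \<noteq> b'" "c' \<in> {a, b, c}" for a' b' c'
    using two_free[OF that(1-5)] slack_free_any[OF S[OF that(6)]] by metis
  have t_case: ?thesis if t: "slack_at (transp m) a' v" "slack_at (transp m) b' v" "a' \<noteq> b'" "c' \<noteq> a'" "c' \<noteq> b'" "c' \<in> {a, b, c}" for a' b' c'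
  proof -
    obtain p q where "free (del_vertex v m) c' p q" using slack_free_any[OF S[OF t(6)]] by metis
    then have "free (del_vertex v (transp m)) c' q p" by (simp add: free_transp flip: transp_del)
    moreover have "indeg (transp m) c' + outdeg (transp m) c' = 3"
      using slack_free_any(2)[OF S[OF t(6)]] by (simp add: add.commute)
    ultimately obtain n p q n' p' q' where n: "free (del_vertex v (transp m)) n p q" "free (del_vertex v (transp m)) n' p' q'" "n \<noteq> n'"
      "del_vertex v (transp m) n n' = 0" "del_vertex v (transp m) n' n = 0" "\<not> (q = p' \<and> q' = p)"
      using minimal_counterexample.two_free[OF transposed t(1-5)] by blast
    then have "free (del_vertex v m) n q p" "free (del_vertex v m) n' q' p'" "del_vertex v m n n' = 0" "del_vertex v m n' n = 0"
      by (auto simp: free_transp transp_apply simp flip: transp_del)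
    then show ?thesis using n(3,6) by blast
  qed
  show ?thesis using S[of a] S[of b] S[of c] abc(2-4) m_case[of a b c] m_case[of a c b] m_case[of b c a]
      t_case[of a b c] t_case[of a c b] t_case[of b c a] by auto
qed

text \<open>One or two charges, at most 276, are covered by one contraction (290); three or more, at
  most 552, by two (580).\<close>

lemma back_bound_del_bonus:
  assumes "v \<in> V" "indeg m v > 0"
  shows "\<exists>B. back_bound (del_vertex v m) B \<and> B + bonus v \<le> potential (del_vertex v m)"
proof -
  let ?k = "del_vertex v m" and ?N = "{u\<in>V. slack_at m u v \<or> slack_at (transp m) u v}"
  note g = admissible_del[OF admissible, of v]
  have s: "num_arcs ?k < num_arcs m" using assms by (intro num_arcs_del) auto
  consider "card ?N = 0" | "card ?N = 1 \<or> card ?N = 2" | "card ?N \<ge> 3" by linarith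
  then show ?thesis
  proof cases
    case 1
    then have "bonus v = 0" using bonus_le_card[of v, unfolded 1] by simp
    then show ?thesis using smaller[OF g s] by auto
  next
    case 2
    then have "?N \<noteq> {}" by (metis card.empty zero_neq_one zero_neq_numeral)
    then obtain u p q where f: "free ?k u p q" using slack_free_any(1) by blast
    have "back_bound (contract u p ?k) (potential (contract u p ?k))" using contract_free(1,2)[OF g f] s by (intro smaller) auto
    then have "back_bound ?k (potential (contract u p ?k))" by (rule contract_free(4)[OF g f])
    moreover have "bonus v \<le> 276" using bonus_le_card[of v] 2 by auto
    ultimately show ?thesis using contract_free(3)[OF g f] by (intro exI[of _ "potential (contract u p ?k)"]) simp
  next
    case 3
    obtain n p q n' p' q' where f: "free ?k n p q" "free ?k n' p' q'" "n \<noteq> n'" "?k n n' = 0" "?k n' n = 0"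
      "\<not> (q = p' \<and> q' = p)" using two_free_any[OF 3] by blast
    let ?l = "contract n p ?k"
    note g' = contract_free(1)[OF g f(1)]
    note f' = free_contract[OF g f]
    have "back_bound (contract n' p' ?l) (potential (contract n' p' ?l))"
      using contract_free(1,2)[OF g' f'] contract_free(2)[OF g f(1)] s by (intro smaller) auto
    then have "back_bound ?k (potential (contract n' p' ?l))" using contract_free(4)[OF g f(1)] contract_free(4)[OF g' f'] by blast
    then show ?thesis using contract_free(3)[OF g f(1)] contract_free(3)[OF g' f'] bonus_le_552[OF assms(1)]
      by (intro exI[of _ "potential (contract n' p' ?l)"]) simp
  qed
qed

lemma del_bound:
  assumes "v \<in> V"
  shows "potential m + bonus v \<le> potential (del_vertex v m) + 870 * min (indeg m v) (outdeg m v)"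
    "indeg m v > 0 \<Longrightarrow> potential m + bonus v < potential (del_vertex v m) + 870 * min (indeg m v) (outdeg m v)"
proof -
  show *: "potential m + bonus v < potential (del_vertex v m) + 870 * min (indeg m v) (outdeg m v)" if pos: "indeg m v > 0"
  proof -
    obtain B where B: "back_bound (del_vertex v m) B" "B + bonus v \<le> potential (del_vertex v m)"
      using back_bound_del_bonus[OF assms pos] by blast
    have "\<not> B + 870 * min (indeg m v) (outdeg m v) \<le> potential m"
      using contradiction[OF back_bound_del[OF assms B(1)]] by blast
    then show ?thesis using B(2) by linarith
  qed
  show "potential m + bonus v \<le> potential (del_vertex v m) + 870 * min (indeg m v) (outdeg m v)"
  proof (cases "indeg m v = 0")
    case True
    then have z: "outdeg m v = 0" using no_source_or_sink[OF assms] by simp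
    have "m v w = 0" "m w v = 0" for w
      using arc_degrees[of v w] arc_degrees[of w v] True z by (metis not_gr_zero not_one_le_zero)+
    then have "del_vertex v m = m" by (auto simp: del_vertex_def fun_eq_iff)
    moreover have "bonus v = 0"
      using sum_share_le(1)[of v] minimal_counterexample.sum_share_le(1)[OF transposed, of v] True z
      by (simp add: bonus_def sum.distrib)
    ultimately show ?thesis by simp
  qed (use * in auto)
qed

text \<open>By \<open>no_double_triangle\<close>, \<open>y\<close> or \<open>z\<close> satisfies
  \<open>slack_at\<close>; one alone takes 138, both take 69 each.\<close>

lemma sum_share:
  assumes u: "indeg m u = 1" "outdeg m u = 2" and y: "m u y = 1"
  shows "(\<Sum>v\<in>V. share m u v) \<ge> 138"
proof -
  obtain x where x: "m x u > 0" using exists_in[of m u] u by auto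
  obtain z where z: "z \<noteq> y" "m u z > 0" "z \<in> V" using other_out[of u y] u y by auto
  have V: "x \<in> V" "y \<in> V" using arcD(1)[OF x] arcD(2)[of u y] y by auto
  have uz: "m u z = 1" using le_outd2[of y z m u] V z y u by auto
  have outs: "w = y \<or> w = z" if "m u w > 0" for w
    using only_other_out[OF u(2) _ z(2,1) that] y by auto
  have ins: "w = x" if "m w u > 0" for w
    using le_ind2[of w x m u] that V u x arcD(1)[OF that] by (cases "w = x") auto
  have sy: "slack_at m u y \<longleftrightarrow> m z x = 0" 
    using u y z x ins outs unfolding slack_at_def by metis
  have sz: "slack_at m u z \<longleftrightarrow> m y x = 0" 
    using u uz z x y ins outs unfolding slack_at_def by (metis zero_less_one)
  have "m y x = 0 \<or> m z x = 0" using no_double_triangle[OF u x z(1)[symmetric] _ z(2)] y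
    by (cases "m y x = 0") auto
  moreover have "w = y \<or> w = z" if "slack_at m u w" for w using that outs by (auto simp: slack_at_def)
  ultimately have "138 \<le> share m u y + share m u z" using sy sz z(1) unfolding share_def by auto
  also have "\<dots> = (\<Sum>v\<in>{y, z}. share m u v)" using z(1) by simp
  also have "\<dots> \<le> (\<Sum>v\<in>V. share m u v)" using V z by (intro sum_mono2) auto
  finally show ?thesis .
qed

text \<open>The factor 3 accounts for the slope \<open>124/3\<close> needed at out-arcs of vertices of type \<open>(1, 3)\<close>.\<close>

lemma sum_del_slope:
  assumes w: "w \<in> V" and slope: "\<And>a b. a = 0 \<or> b = 0 \<Longrightarrow> a \<le> indeg m w \<Longrightarrow> b \<le> outdeg m w \<Longrightarrow> (\<exists>v. b = m w v) \<Longrightarrow>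
    3 * pot (indeg m w - a) (outdeg m w - b) + A * a + B * b \<le> 3 * pot (indeg m w) (outdeg m w)"
  shows "3 * (\<Sum>v\<in>V. weight (del_vertex v m) w) + 3 * weight m w + A * indeg m w + B * outdeg m w \<le> 3 * (card V * weight m w)"
proof -
  \<comment> \<open>The term \<open>v = w\<close> is split off: there the whole weight of
    \<open>w\<close> is lost, which is the summand \<open>3 * weight m w\<close> of the
    claim.\<close>
  have "(\<Sum>v\<in>V - {w}. 3 * weight (del_vertex v m) w + A * m v w + B * m w v) \<le> (\<Sum>v\<in>V - {w}. 3 * weight m w)"
  proof (intro sum_mono)
    fix v assume v: "v \<in> V - {w}"
    have "indeg (del_vertex v m) w = indeg m w - m v w" "outdeg (del_vertex v m) w = outdeg m w - m w v"
      using indeg_del[of v w m] outdeg_del[of v w m] v by auto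
    moreover have "m v w = 0 \<or> m w v = 0" using arcD(3)[of v w] by (cases "m v w = 0") auto
    ultimately show "3 * weight (del_vertex v m) w + A * m v w + B * m w v \<le> 3 * weight m w"
      unfolding weight_def using slope[of "m v w" "m w v"] le_indeg[of v m w] le_outdeg[of v m w] v by auto
  qed
  moreover have "(\<Sum>v\<in>V - {w}. 3 * weight (del_vertex v m) w + A * m v w + B * m w v) =
    3 * (\<Sum>v\<in>V. weight (del_vertex v m) w) + A * indeg m w + B * outdeg m w"
    using sum.remove[OF finite_V w, of "\<lambda>v. weight (del_vertex v m) w"] indeg_remove[OF w, of m w] outdeg_remove[OF w, of m w]
    by (simp only: sum.distrib sum_distrib_left[symmetric] no_loop weight_isolated indeg_del_self add_0)
  moreover have "(\<Sum>v\<in>V - {w}. 3 * weight m w) + 3 * weight m w = 3 * (card V * weight m w)"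
    using sum.remove[OF finite_V w, of "\<lambda>v. 3 * weight m w"] by simp
  ultimately show ?thesis by linarith
qed

lemma averaging_half:
  assumes w: "w \<in> V" "indeg m w > 0" "indeg m w \<le> outdeg m w"
  shows "3 * (\<Sum>v\<in>V. weight (del_vertex v m) w) + 2610 * min (indeg m w) (outdeg m w) \<le>
    3 * (card V * weight m w) + 3 * (\<Sum>v\<in>V. share m w v)"
proof -
  consider "indeg m w = 2" "outdeg m w = 3" | "indeg m w = 2" "outdeg m w = 2" | "indeg m w = 1" "outdeg m w = 3"
    | y where "indeg m w = 1" "outdeg m w = 2" "m w y = 1"
    | "indeg m w = 1" "outdeg m w = 2" "\<forall>y. m w y \<noteq> 1"
    using types[OF w(1,2)] w(3) by auto
  then show ?thesis
  proof cases
    case 1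
    then show ?thesis using sum_del_slope[OF w(1), of 1041 327] pot_slope(1) by (simp add: weight_def)
  next
    case 2
    then show ?thesis using sum_del_slope[OF w(1), of 849 849] pot_slope(2) by (simp add: weight_def)
  next
    case 3
    then show ?thesis using sum_del_slope[OF w(1), of 1119 124] pot_slope(3) by (simp add: weight_def)
  next
    case 4
    then show ?thesis using sum_del_slope[OF w(1), of 984 114] pot_slope(4) sum_share[of w y] by (simp add: weight_def)
  next
    case 5
    have "3 * (\<Sum>v\<in>V. weight (del_vertex v m) w) + 3 * weight m w + 984 * indeg m w + 492 * outdeg m w \<le> 3 * (card V * weight m w)"
    proof (rule sum_del_slope[OF w(1)])
      fix a b assume "a = 0 \<or> b = 0" "a \<le> indeg m w" "b \<le> outdeg m w" "\<exists>v. b = m w v"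
      then show "3 * pot (indeg m w - a) (outdeg m w - b) + 984 * a + 492 * b \<le> 3 * pot (indeg m w) (outdeg m w)"
        using pot_slope(5)[of a b "indeg m w" "outdeg m w"] 5 by auto
    qed
    then show ?thesis using 5 by (simp add: weight_def)
  qed
qed

lemma averaging:
  assumes w: "w \<in> V"
  shows "(\<Sum>v\<in>V. weight (del_vertex v m) w) + 870 * min (indeg m w) (outdeg m w) \<le>
    card V * weight m w + (\<Sum>v\<in>V. share m w v + share (transp m) w v)"
proof (cases "indeg m w = 0")
  case True
  have "(\<Sum>v\<in>V. weight (del_vertex v m) w) \<le> (\<Sum>v\<in>V. weight m w)" by (intro sum_mono weight_mono del_le)
  then show ?thesis using True by simp
next
  case False
  have "3 * (\<Sum>v\<in>V. weight (del_vertex v m) w) + 2610 * min (indeg m w) (outdeg m w) \<le>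
    3 * (card V * weight m w) + 3 * ((\<Sum>v\<in>V. share m w v) + (\<Sum>v\<in>V. share (transp m) w v))"
  proof (cases "indeg m w \<le> outdeg m w")
    case True
    then show ?thesis using averaging_half[OF w] False by simp
  next
    case gt: False
    have "indeg (transp m) w > 0" "indeg (transp m) w \<le> outdeg (transp m) w"
      using gt no_source_or_sink[OF w] False by auto
    then show ?thesis using minimal_counterexample.averaging_half[OF transposed w]
      by (simp add: min.commute flip: transp_del)
  qed
  then show ?thesis by (simp add: sum.distrib)
qed

lemma absurd: False
proof -
  have "\<exists>v\<in>V. indeg m v > 0"
  proof (rule ccontr)
    assume *: "\<not> ?thesis"
    then have m0: "m a b = 0" for a b
      using arc_degrees[of a b] arcD[of a b] by (cases "m a b = 0") force+
    obtain f :: "'a \<Rightarrow> nat" where "inj_on f V" using finite_imp_inj_to_nat_seg[OF finite_V] by metis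
    then have "inj_on (\<lambda>v. real (f v)) V" by (auto simp: inj_on_def)
    then have "back_bound m 0" unfolding back_bound_def back_arcs_def by (intro exI[of _ "\<lambda>v. real (f v)"]) (simp add: m0)
    then show False using contradiction by blast
  qed
  then obtain v where v: "v \<in> V" "indeg m v > 0" by blast
  \<comment> \<open>Strict because of the non-isolated \<open>v\<close>. Exchanging the sums and
    applying \<open>averaging\<close> leads back to the left side.\<close>
  have "(\<Sum>v\<in>V. potential m + bonus v) < (\<Sum>v\<in>V. potential (del_vertex v m) + 870 * min (indeg m v) (outdeg m v))"
    using del_bound v by (intro sum_strict_mono_ex1) auto
  also have "\<dots> = (\<Sum>w\<in>V. (\<Sum>v\<in>V. weight (del_vertex v m) w) + 870 * min (indeg m w) (outdeg m w))"
    unfolding potential_def sum.distrib by (subst sum.swap) simp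
  also have "\<dots> \<le> (\<Sum>w\<in>V. card V * weight m w + (\<Sum>v\<in>V. share m w v + share (transp m) w v))"
    by (intro sum_mono averaging)
  also have "\<dots> = (\<Sum>v\<in>V. potential m + bonus v)"
    unfolding potential_def bonus_def sum.distrib[of "\<lambda>w. card V * weight m w"] sum.distrib[of "\<lambda>v. \<Sum>w\<in>V. weight m w"]
    by (subst (2) sum.swap) (simp add: sum_distrib_left)
  finally show False by simp
qed

end

theorem (in vertex_set) back_bound_potential:
  assumes "admissible m"
  shows "back_bound m (potential m)"
  using assms
proof (induction "num_arcs m" arbitrary: m rule: less_induct)
  case less
  show ?case
  proof (rule ccontr)
    assume "\<not> back_bound m (potential m)"
    then interpret minimal_counterexample V m
      using less by unfold_locales auto
    show False by (rule absurd)
  qed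
qed

section \<open>From vertex orders to feedback arc sets\<close>

lemma sum_card_fibres:
  assumes "finite S" "finite T" "g ` S \<subseteq> T"
  shows "(\<Sum>t\<in>T. card {x\<in>S. g x = t}) = card S"
  using sum.group[OF assms, of "\<lambda>_. 1::nat"] by simp

lemma cas_increasing:
  fixes \<rho> :: "'a \<Rightarrow> real"
  assumes "pre_digraph.cas G u p v" "p \<noteq> []" "\<forall>e\<in>set p. \<rho> (tail G e) < \<rho> (head G e)"
  shows "\<rho> u < \<rho> v"
  using assms
proof (induction p arbitrary: u)
  case (Cons e p)
  then show ?case by (cases "p = []") (force simp: pre_digraph.cas.simps)+
qed simp

theorem theorem3:
  fixes D :: "('a, 'b) pre_digraph" and n :: nat
  assumes "oriented_multigraph D"
    and "degree_regular 5 D"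
    and "card (verts D) = n"
  shows "real (fas D) \<le> 24 * real n / 29"
proof -
  interpret oriented_multigraph D by fact
  interpret vertex_set "verts D" by unfold_locales simp
  define m where "m u v = card {e \<in> arcs D. tail D e = u \<and> head D e = v}" for u v
  have pos: "m u v > 0 \<longleftrightarrow> (\<exists>e\<in>arcs D. tail D e = u \<and> head D e = v)" for u v
    by (auto simp: m_def card_gt_0_iff)
  have no_2: "m v u = 0" if uv: "m u v > 0" for u v
  proof (rule ccontr)
    assume "m v u \<noteq> 0"
    then obtain e e' where e: "e \<in> arcs D" "e' \<in> arcs D" "tail D e = u" "head D e = v" "tail D e' = v" "head D e' = u"
      using uv pos[of u v] pos[of v u] by auto
    moreover have "u \<noteq> v" using no_loops[OF e(1)] e by auto
    ultimately have "cycle [e, e']" unfolding cycle_def awalk_def by (intro exI[of _ u]) auto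
    then show False using no_2_cycle by force
  qed
  have indeg: "indeg m v = in_degree D v" for v
  proof -
    have "in_degree D v = (\<Sum>w\<in>verts D. card {e \<in> in_arcs D v. tail D e = w})"
      unfolding in_degree_def by (rule sum_card_fibres[symmetric]) auto
    also have "\<dots> = indeg m v" unfolding indeg_def m_def by (intro sum.cong arg_cong[where f = card]) auto
    finally show ?thesis by simp
  qed
  have outdeg: "outdeg m v = out_degree D v" for v
  proof -
    have "out_degree D v = (\<Sum>w\<in>verts D. card {e \<in> out_arcs D v. head D e = w})"
      unfolding out_degree_def by (rule sum_card_fibres[symmetric]) auto
    also have "\<dots> = outdeg m v" unfolding outdeg_def m_def by (intro sum.cong arg_cong[where f = card]) auto
    finally show ?thesis by simp
  qed
  have "admissible m" unfolding admissible_def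
    using pos no_2 indeg outdeg assms(2) by (force simp: degree_regular_def degree_def)
  then obtain \<rho> where \<rho>: "inj_on \<rho> (verts D)" "870 * back_arcs m \<rho> \<le> potential m"
    using back_bound_potential unfolding back_bound_def by blast
  \<comment> \<open>Positions increase along all arcs outside \<open>F\<close>, so no directed cycle
    survives.\<close>
  define F where "F = {e \<in> arcs D. \<rho> (head D e) < \<rho> (tail D e)}"
  have "card F = (\<Sum>t\<in>verts D \<times> verts D. card {e \<in> F. (tail D e, head D e) = t})"
    by (rule sum_card_fibres[symmetric]) (auto simp: F_def)
  also have "\<dots> = back_arcs m \<rho>"
    unfolding back_arcs_def sum.cartesian_product
    by (intro sum.cong) (auto simp: F_def m_def intro!: arg_cong[where f = card])
  finally have "870 * card F \<le> potential m" using \<rho>(2) by simp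
  also have "potential m \<le> n * 720"
    unfolding potential_def weight_def assms(3)[symmetric] by (rule sum_bounded_above[THEN order_trans]) (auto intro: pot_le_720)
  finally have "29 * card F \<le> 24 * n" by simp
  moreover have "feedback_arc_set D F"
  proof -
    have "\<not> pre_digraph.cycle (del_arcs D F) p" for p
    proof
      assume "pre_digraph.cycle (del_arcs D F) p"
      then obtain u where u: "pre_digraph.cas (del_arcs D F) u p u" "p \<noteq> []" "set p \<subseteq> arcs D - F"
        by (auto simp: pre_digraph.cycle_def pre_digraph.awalk_def del_arcs_def)
      have "\<rho> (tail D e) < \<rho> (head D e)" if "e \<in> set p" for e
      proof -
        have e: "e \<in> arcs D" "e \<notin> F" using that u(3) by auto
        then have "\<rho> (tail D e) \<noteq> \<rho> (head D e)" using \<rho>(1) no_loops by (auto dest: inj_onD)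
        then show ?thesis using e by (auto simp: F_def)
      qed
      then show False using cas_increasing[OF u(1,2), of \<rho>] by (auto simp: del_arcs_def)
    qed
    then show ?thesis by (auto simp: feedback_arc_set_def F_def)
  qed
  then have "fas D \<le> card F" unfolding fas_def by (intro Least_le) blast
  ultimately have "29 * fas D \<le> 24 * n" by linarith
  then have "29 * real (fas D) \<le> 24 * real n" by (metis of_nat_le_iff of_nat_mult of_nat_numeral)
  then show ?thesis by simp
qed

end
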